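(* Let $T>0$ and $g\in C^3_c(\mathbb{R})$. With $t^{(m)}:=\lfloor t2^{2m}\rfloor2^{-2m}$, $$\lim_{m\to\infty}f_m(t^{(m)},x)=\lim_{m\to\infty}r_m^{\lfloor t2^{2m}\rfloor-\lfloor T2^{2m}\rfloor}\,\mathbb{E}^x_{\mathbb{Q}_m}\left(g(S_m(T^{(m)}-t^{(m)}))\right)=e^{-r(T-t)}\,\mathbb{E}^x_{\mathbb{Q}}\left(g(S(T-t))\right)=f(t,x)$$ for any $0\le t\le T$ and $x>0$. Moreover, the price function $f(t,x)$ of the claim $g(S(T))$ is a solution of the Black--Scholes partial differential equation $$\partial_tf(t,x)+rx\,\partial_xf(t,x)+\frac12\sigma^2x^2\,\partial_{xx}f(t,x)-rf(t,x)=0,$$ with boundary condition $f(T,x)=g(x)$, where $0\le t\le T$ and $x>0$ are arbitrary.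
   Context: $C^3_c(\mathbb{R})$: three times continuously differentiable functions with compact support. Fixed parameters: $\mu\in\mathbb{R}$, $\sigma>0$, $r>0$. Time derivatives at the endpoints $t=0,T$ are one-sided. Discrete model. For an integer $m\ge0$: $t_k=k2^{-2m}$, $N=\lfloor T2^{2m}\rfloor$, $r_m=1+r2^{-2m}$, $u_m=1+\sigma2^{-m}+\mu2^{-2m}$, $d_m=1-\sigma2^{-m}+\mu2^{-2m}$, $q_m^\pm=\frac12\pm\frac12\frac{r-\mu}{\sigma}2^{-m}$; only $m$ with $0<q_m^+<1$ are considered. Under $\mathbb{Q}_m$ the stock price $S_m(t_k)$ is the Markov chain whose successive ratios $S_m(t_{k+1})/S_m(t_k)$ are independent and equal $u_m$ with probability $q_m^+$ and $d_m$ with probability $q_m^-$; $\mathbb{E}^x_{\mathbb{Q}_m}$ denotes expectation when the chain starts from $S_m(0)=x$. Thus $$f_m(t_k,x)=r_m^{k-N}\,\mathbb{E}^x_{\mathbb{Q}_m}(g(S_m(t_{N-k})))=r_m^{k-N}\sum_{i=0}^{N-k}\binom{N-k}{i}(q_m^+)^i(q_m^-)^{N-k-i}g(xu_m^id_m^{N-k-i}).$$ Continuous model. Under $\mathbb{Q}$, started from $x$, $S(t)=x\exp((r-\sigma^2/2)t+\sigma W(t))$ with $W$ a $\mathbb{Q}$-Brownian motion, $\mathbb{E}^x_{\mathbb{Q}}$ is the corresponding expectation, and $f(t,x)=e^{-r(T-t)}\mathbb{E}^x_{\mathbb{Q}}(g(S(T-t)))$. *)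

theory Defs
  imports "HOL-Probability.Probability"
begin

definition C3_compact_support :: "(real \<Rightarrow> real) \<Rightarrow> bool" where
  "C3_compact_support g \<longleftrightarrow>
     (\<forall>k<3. \<forall>x. ((deriv ^^ k) g) differentiable (at x)) \<and>
     continuous_on UNIV ((deriv ^^ 3) g) \<and>
     compact (closure {x. g x \<noteq> 0})"

definition grid_time :: "nat \<Rightarrow> nat \<Rightarrow> real" where
  "grid_time m k = real k / 2 ^ (2 * m)"

definition grid_index :: "nat \<Rightarrow> real \<Rightarrow> int" where
  "grid_index m t = \<lfloor>t * 2 ^ (2 * m)\<rfloor>"

definition grid_floor :: "nat \<Rightarrow> real \<Rightarrow> real" where
  "grid_floor m t = real_of_int (grid_index m t) / 2 ^ (2 * m)"

definition interest_factor :: "real \<Rightarrow> nat \<Rightarrow> real" where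
  "interest_factor r m = 1 + r / 2 ^ (2 * m)"

definition up_factor :: "real \<Rightarrow> real \<Rightarrow> nat \<Rightarrow> real" where
  "up_factor \<mu> \<sigma> m = 1 + \<sigma> / 2 ^ m + \<mu> / 2 ^ (2 * m)"

definition down_factor :: "real \<Rightarrow> real \<Rightarrow> nat \<Rightarrow> real" where
  "down_factor \<mu> \<sigma> m = 1 - \<sigma> / 2 ^ m + \<mu> / 2 ^ (2 * m)"

definition q_up :: "real \<Rightarrow> real \<Rightarrow> real \<Rightarrow> nat \<Rightarrow> real" where
  "q_up \<mu> \<sigma> r m = 1 / 2 + 1 / 2 * ((r - \<mu>) / \<sigma>) / 2 ^ m"

definition q_down :: "real \<Rightarrow> real \<Rightarrow> real \<Rightarrow> nat \<Rightarrow> real" where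
  "q_down \<mu> \<sigma> r m = 1 / 2 - 1 / 2 * ((r - \<mu>) / \<sigma>) / 2 ^ m"

text \<open>
  The process \<open>S\<close>, observed at the grid times, is under \<open>M\<close> the binomial chain started from \<open>x\<close>.
  The successive ratios are the \<open>\<xi> k\<close>. They are introduced multiplicatively because
  \<open>down_factor \<mu> \<sigma> m\<close> may vanish for some small \<open>m\<close>, in which case the price can reach \<open>0\<close> and a
  quotient of prices would be meaningless; otherwise \<open>\<xi> k\<close> is almost surely the quotient.
\<close>

definition binomial_chain ::
    "real \<Rightarrow> real \<Rightarrow> real \<Rightarrow> nat \<Rightarrow> real \<Rightarrow> 'a measure \<Rightarrow> (real \<Rightarrow> 'a \<Rightarrow> real) \<Rightarrow> bool" where
  "binomial_chain \<mu> \<sigma> r m x M S \<longleftrightarrow>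
     prob_space M \<and>
     (\<forall>k. S (grid_time m k) \<in> borel_measurable M) \<and>
     (AE \<omega> in M. S 0 \<omega> = x) \<and>
     (\<exists>\<xi> :: nat \<Rightarrow> 'a \<Rightarrow> real.
        prob_space.indep_vars M (\<lambda>_. borel) \<xi> UNIV \<and>
        (\<forall>k. measure M {\<omega> \<in> space M. \<xi> k \<omega> = up_factor \<mu> \<sigma> m} = q_up \<mu> \<sigma> r m) \<and>
        (\<forall>k. measure M {\<omega> \<in> space M. \<xi> k \<omega> = down_factor \<mu> \<sigma> m} = q_down \<mu> \<sigma> r m) \<and>
        (\<forall>k. AE \<omega> in M. S (grid_time m (Suc k)) \<omega> = S (grid_time m k) \<omega> * \<xi> k \<omega>))"

text \<open>
  The discrete price, as a function of a grid time \<open>s\<close>: for \<open>s = grid_time m k\<close> we have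
  \<open>grid_index m s = k\<close>. The measure \<open>Q m x\<close> is the law of the \<open>m\<close>-th model with
  starting value \<open>x\<close>.
\<close>

definition discrete_price ::
    "real \<Rightarrow> real \<Rightarrow> (real \<Rightarrow> real) \<Rightarrow> (nat \<Rightarrow> real \<Rightarrow> 'a measure) \<Rightarrow> (nat \<Rightarrow> real \<Rightarrow> 'a \<Rightarrow> real)
      \<Rightarrow> nat \<Rightarrow> real \<Rightarrow> real \<Rightarrow> real" where
  "discrete_price r T g Q S m s x =
     (let k = grid_index m s; N = grid_index m T in
        interest_factor r m powi (k - N) *
        (\<integral>\<omega>. g (S m (grid_time m (nat (N - k))) \<omega>) \<partial>(Q m x)))"

definition brownian_motion :: "'b measure \<Rightarrow> (real \<Rightarrow> 'b \<Rightarrow> real) \<Rightarrow> bool" where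
  "brownian_motion M W \<longleftrightarrow>
     prob_space M \<and>
     (\<forall>t\<ge>0. W t \<in> borel_measurable M) \<and>
     (AE \<omega> in M. W 0 \<omega> = 0) \<and>
     (\<forall>n (s :: nat \<Rightarrow> real). 0 \<le> s 0 \<and> (\<forall>i<n. s i \<le> s (Suc i)) \<longrightarrow>
        prob_space.indep_vars M (\<lambda>_. borel) (\<lambda>i \<omega>. W (s (Suc i)) \<omega> - W (s i) \<omega>) {..<n}) \<and>
     (\<forall>s t. 0 \<le> s \<and> s < t \<longrightarrow>
        distributed M lborel (\<lambda>\<omega>. W t \<omega> - W s \<omega>) (\<lambda>y. ennreal (normal_density 0 (sqrt (t - s)) y))) \<and>
     (AE \<omega> in M. continuous_on {0..} (\<lambda>t. W t \<omega>))"

definition stock_price :: "real \<Rightarrow> real \<Rightarrow> (real \<Rightarrow> 'b \<Rightarrow> real) \<Rightarrow> real \<Rightarrow> real \<Rightarrow> 'b \<Rightarrow> real" where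
  "stock_price r \<sigma> W x t \<omega> = x * exp ((r - \<sigma>\<^sup>2 / 2) * t + \<sigma> * W t \<omega>)"

definition price ::
    "real \<Rightarrow> real \<Rightarrow> real \<Rightarrow> (real \<Rightarrow> real) \<Rightarrow> 'b measure \<Rightarrow> (real \<Rightarrow> 'b \<Rightarrow> real) \<Rightarrow> real \<Rightarrow> real \<Rightarrow> real" where
  "price r \<sigma> T g M W t x =
     exp (- r * (T - t)) * (\<integral>\<omega>. g (stock_price r \<sigma> W x (T - t) \<omega>) \<partial>M)"

text \<open>
  The derivatives \<open>F_t\<close>, \<open>F_x\<close>, \<open>F_xx\<close> are required to exist everywhere on the domain. The time
  derivative is taken within \<open>{0..T}\<close>, so it is one-sided at \<open>0\<close> and at \<open>T\<close>.
\<close>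

definition solves_black_scholes :: "real \<Rightarrow> real \<Rightarrow> real \<Rightarrow> (real \<Rightarrow> real \<Rightarrow> real) \<Rightarrow> bool" where
  "solves_black_scholes r \<sigma> T F \<longleftrightarrow>
     (\<exists>F_t F_x F_xx :: real \<Rightarrow> real \<Rightarrow> real. \<forall>t\<in>{0..T}. \<forall>x>0.
        ((\<lambda>s. F s x) has_real_derivative F_t t x) (at t within {0..T}) \<and>
        ((\<lambda>y. F t y) has_real_derivative F_x t x) (at x) \<and>
        ((\<lambda>y. F_x t y) has_real_derivative F_xx t x) (at x) \<and>
        F_t t x + r * x * F_x t x + 1 / 2 * \<sigma>\<^sup>2 * x\<^sup>2 * F_xx t x - r * F t x = 0)"

end

(* Both halves of the theorem are read off the log-price.

   Convergence: with h = 2^-m, the characteristic function of one discrete log-return is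
   1 + h^2 z + o(h^2), where z = i theta (r - sigma^2/2) - theta^2 sigma^2 / 2. Raised to a power n with
   n h^2 --> T - t it tends to exp ((T - t) z), the characteristic function of the continuous
   log-return, and Levy's continuity theorem gives convergence of the expectations.

   Black--Scholes equation: G y = g (exp y) has three bounded derivatives. For
   Y t = y + a t + sigma W t and s < t, independence of increments and Taylor expansion at Y s give
   E G (Y t) - E G (Y s) = (t - s) (a E G' (Y s) + sigma^2/2 E G'' (Y s)) + O((t - s)^(3/2)) uniformly,
   and the bracket is continuous in s. This yields the time derivative including the end points,
   where the Gaussian density is of no use. *)

theory Submission
  imports Defs "HOL-Real_Asymp.Real_Asymp"
begin

text \<open>The m-th models live on unrelated probability spaces, so only laws can be compared;
  hence characteristic functions. Logarithms turn the product of ratios into an independent sum, but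
  they need both factors to be positive, which holds for large m. The drift mu disappears in the
  limit: per unit of time the tilt of the probabilities contributes r - mu to the mean log-return,
  and the factors contribute mu - sigma^2/2.

  Compact support of g keeps the derivatives of g (exp y) bounded although those of exp are not. A
  bounded third derivative bounds the Taylor remainder by a multiple of the third absolute moment of
  the increment, which is o(t - s). The expansion runs forward only, since an increment is
  independent of the past; a left difference quotient has to be expanded at the earlier, moving
  time, and there the continuity of the bracket enters. Maturity t = T is Brownian time 0.\<close>

subsection \<open>Convergence of the binomial expectations\<close>

(* The characteristic function of one discrete log-return, for h = 2^-m and c = (r - mu) / sigma. *)
definition step_char :: "real \<Rightarrow> real \<Rightarrow> real \<Rightarrow> real \<Rightarrow> real \<Rightarrow> complex" where
  "step_char \<sigma> \<mu> c \<theta> h =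
     (1 / 2 + c / 2 * h) *\<^sub>R iexp (\<theta> * ln (1 + \<sigma> * h + \<mu> * h\<^sup>2)) +
     (1 / 2 - c / 2 * h) *\<^sub>R iexp (\<theta> * ln (1 - \<sigma> * h + \<mu> * h\<^sup>2))"

text \<open>The reference value is exp (h^2 z) rather than 1 + h^2 z because its powers are known
  exactly and its modulus is at most 1. The terms of order h cancel by symmetry; at order h^2 the
  tilt gives c * sigma, the logarithms give mu - sigma^2/2, and the square of the leading term sigma
  * h gives the Gaussian part. Real and imaginary parts are separate real asymptotic
  expansions.\<close>

lemma step_char_expansion:
  fixes \<sigma> \<mu> c \<theta> :: real
  assumes "\<sigma> > 0"
  defines "z \<equiv> Complex (- (\<theta>\<^sup>2 * \<sigma>\<^sup>2 / 2)) (\<theta> * (c * \<sigma> + \<mu> - \<sigma>\<^sup>2 / 2))"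
  shows "((\<lambda>h. (step_char \<sigma> \<mu> c \<theta> h - exp (h\<^sup>2 *\<^sub>R z)) /\<^sub>R h\<^sup>2) \<longlongrightarrow> 0) (at_right 0)"
proof -
  have re: "((\<lambda>h. ((1 / 2 + c / 2 * h) * cos (\<theta> * ln (1 + \<sigma> * h + \<mu> * h\<^sup>2)) +
      (1 / 2 - c / 2 * h) * cos (\<theta> * ln (1 - \<sigma> * h + \<mu> * h\<^sup>2)) -
      exp (- (h\<^sup>2 * (\<theta>\<^sup>2 * \<sigma>\<^sup>2 / 2))) * cos (h\<^sup>2 * (\<theta> * (c * \<sigma> + \<mu> - \<sigma>\<^sup>2 / 2)))) / h\<^sup>2)
      \<longlongrightarrow> 0) (at_right 0)"
    using assms(1) by (real_asymp, simp add: field_simps power2_eq_square)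
  have im: "((\<lambda>h. ((1 / 2 + c / 2 * h) * sin (\<theta> * ln (1 + \<sigma> * h + \<mu> * h\<^sup>2)) +
      (1 / 2 - c / 2 * h) * sin (\<theta> * ln (1 - \<sigma> * h + \<mu> * h\<^sup>2)) -
      exp (- (h\<^sup>2 * (\<theta>\<^sup>2 * \<sigma>\<^sup>2 / 2))) * sin (h\<^sup>2 * (\<theta> * (c * \<sigma> + \<mu> - \<sigma>\<^sup>2 / 2)))) / h\<^sup>2)
      \<longlongrightarrow> 0) (at_right 0)"
    using assms(1) by (real_asymp, simp add: field_simps power2_eq_square)
  have divideR: "Re (w /\<^sub>R k) = Re w / k" "Im (w /\<^sub>R k) = Im w / k" for w k
    by (simp_all add: divide_inverse_commute)
  have Re_eq: "Re (step_char \<sigma> \<mu> c \<theta> h - exp (h\<^sup>2 *\<^sub>R z)) =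
      (1 / 2 + c / 2 * h) * cos (\<theta> * ln (1 + \<sigma> * h + \<mu> * h\<^sup>2)) +
      (1 / 2 - c / 2 * h) * cos (\<theta> * ln (1 - \<sigma> * h + \<mu> * h\<^sup>2)) -
      exp (- (h\<^sup>2 * (\<theta>\<^sup>2 * \<sigma>\<^sup>2 / 2))) * cos (h\<^sup>2 * (\<theta> * (c * \<sigma> + \<mu> - \<sigma>\<^sup>2 / 2)))" for h
    by (simp add: step_char_def z_def Re_exp)
  have Im_eq: "Im (step_char \<sigma> \<mu> c \<theta> h - exp (h\<^sup>2 *\<^sub>R z)) =
      (1 / 2 + c / 2 * h) * sin (\<theta> * ln (1 + \<sigma> * h + \<mu> * h\<^sup>2)) +
      (1 / 2 - c / 2 * h) * sin (\<theta> * ln (1 - \<sigma> * h + \<mu> * h\<^sup>2)) -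
      exp (- (h\<^sup>2 * (\<theta>\<^sup>2 * \<sigma>\<^sup>2 / 2))) * sin (h\<^sup>2 * (\<theta> * (c * \<sigma> + \<mu> - \<sigma>\<^sup>2 / 2)))" for h
    by (simp add: step_char_def z_def Im_exp)
  show ?thesis
    unfolding tendsto_complex_iff divideR Re_eq Im_eq using re im by simp
qed

section \<open>Law of the discrete log-return\<close>

lemma (in prob_space) AE_two_values:
  fixes X :: "'a \<Rightarrow> real"
  assumes [measurable]: "random_variable borel X" and "u \<noteq> d"
    and "prob {\<omega> \<in> space M. X \<omega> = u} + prob {\<omega> \<in> space M. X \<omega> = d} = 1"
  shows "AE \<omega> in M. X \<omega> = u \<or> X \<omega> = d"
proof -
  have "prob {\<omega> \<in> space M. X \<omega> = u \<or> X \<omega> = d} =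
      prob ({\<omega> \<in> space M. X \<omega> = u} \<union> {\<omega> \<in> space M. X \<omega> = d})"
    by (intro arg_cong[where f = prob]) auto
  also have "\<dots> = 1"
    using assms by (subst finite_measure_Union) auto
  finally show ?thesis
    by (subst (asm) prob_Collect_eq_1) auto
qed

lemma (in prob_space) integral_two_values:
  fixes X :: "'a \<Rightarrow> real" and f :: "real \<Rightarrow> 'c::{banach, second_countable_topology}"
  assumes [measurable]: "random_variable borel X" "f \<in> borel_measurable borel" and "u \<noteq> d"
    and p: "prob {\<omega> \<in> space M. X \<omega> = u} = p" and q: "prob {\<omega> \<in> space M. X \<omega> = d} = q"
    and "p + q = 1"
  shows "(\<integral>\<omega>. f (X \<omega>) \<partial>M) = p *\<^sub>R f u + q *\<^sub>R f d"
proof -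
  let ?U = "{\<omega> \<in> space M. X \<omega> = u}" and ?D = "{\<omega> \<in> space M. X \<omega> = d}"
  have ae: "AE \<omega> in M. X \<omega> = u \<or> X \<omega> = d"
    using assms by (intro AE_two_values) auto
  have [simp]: "integrable M (indicat_real ?U)" "integrable M (indicat_real ?D)"
    by (auto simp: integrable_indicator_iff emeasure_eq_measure)
  have "(\<integral>\<omega>. f (X \<omega>) \<partial>M) = (\<integral>\<omega>. indicator ?U \<omega> *\<^sub>R f u + indicator ?D \<omega> *\<^sub>R f d \<partial>M)"
  proof (rule integral_cong_AE)
    show "AE \<omega> in M. f (X \<omega>) = indicator ?U \<omega> *\<^sub>R f u + indicator ?D \<omega> *\<^sub>R f d"
      using ae AE_space by eventually_elim (use \<open>u \<noteq> d\<close> in \<open>auto simp: indicator_def\<close>)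
  qed measurable
  also have "\<dots> = p *\<^sub>R f u + q *\<^sub>R f d"
    by (subst Bochner_Integration.integral_add) (auto simp: p q)
  finally show ?thesis .
qed

text \<open>Passing to a law on the real line removes the probability space, which varies with m.
  The factors must be positive for the price to be x times an exponential.\<close>

lemma binomial_chain_law:
  fixes x :: real
  assumes chain: "binomial_chain \<mu> \<sigma> r m x M S" and "\<sigma> > 0" "x > 0"
    and up: "up_factor \<mu> \<sigma> m > 0" and down: "down_factor \<mu> \<sigma> m > 0"
  obtains \<nu> where "real_distribution \<nu>"
    and "\<And>\<theta>. char \<nu> \<theta> = step_char \<sigma> \<mu> ((r - \<mu>) / \<sigma>) \<theta> (1 / 2 ^ m) ^ n"
    and "\<And>g :: real \<Rightarrow> real. g \<in> borel_measurable borel \<Longrightarrow>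
      (\<integral>\<omega>. g (S (grid_time m n) \<omega>) \<partial>M) = (\<integral>y. g (x * exp y) \<partial>\<nu>)"
proof -
  let ?u = "up_factor \<mu> \<sigma> m" and ?d = "down_factor \<mu> \<sigma> m"
  from chain interpret prob_space M
    by (simp add: binomial_chain_def)
  from chain have [measurable]: "S (grid_time m k) \<in> borel_measurable M" for k
    by (simp add: binomial_chain_def)
  from chain obtain \<xi> where
    indep: "indep_vars (\<lambda>_. borel) \<xi> (UNIV :: nat set)" and
    pu: "\<And>k. prob {\<omega> \<in> space M. \<xi> k \<omega> = ?u} = q_up \<mu> \<sigma> r m" and
    pd: "\<And>k. prob {\<omega> \<in> space M. \<xi> k \<omega> = ?d} = q_down \<mu> \<sigma> r m" and
    start: "AE \<omega> in M. S 0 \<omega> = x" and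
    step: "\<And>k. AE \<omega> in M. S (grid_time m (Suc k)) \<omega> = S (grid_time m k) \<omega> * \<xi> k \<omega>"
    by (auto simp: binomial_chain_def)
  have [measurable]: "random_variable borel (\<xi> k)" for k
    using indep by (simp add: indep_vars_def)
  have ud: "?u \<noteq> ?d"
    using \<open>\<sigma> > 0\<close> by (simp add: up_factor_def down_factor_def field_simps)
  have pq: "q_up \<mu> \<sigma> r m + q_down \<mu> \<sigma> r m = 1"
    by (simp add: q_up_def q_down_def)
  have vals: "AE \<omega> in M. \<xi> k \<omega> = ?u \<or> \<xi> k \<omega> = ?d" for k
    using ud pq pu pd by (intro AE_two_values) auto
  \<comment> \<open>Each ratio is almost surely one of two positive values, so exp undoes ln at
    every step.\<close>
  have S_eq: "AE \<omega> in M. S (grid_time m n) \<omega> = x * exp (\<Sum>k<n. ln (\<xi> k \<omega>))" for n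
  proof (induction n)
    case 0
    then show ?case using start by (simp add: grid_time_def)
  next
    case (Suc n)
    with step[of n] vals[of n] show ?case
      by eventually_elim (use up down in \<open>auto simp: exp_add\<close>)
  qed
  define L where "L \<omega> = (\<Sum>k<n. ln (\<xi> k \<omega>))" for \<omega>
  have [measurable]: "L \<in> borel_measurable M"
    unfolding L_def by measurable
  have "indep_vars (\<lambda>_. borel) (\<lambda>k \<omega>. ln (\<xi> k \<omega>)) {..<n}"
    by (rule indep_vars_compose2[OF indep_vars_subset[OF indep]]) auto
  then have "char (distr M borel L) \<theta> = (\<Prod>k<n. char (distr M borel (\<lambda>\<omega>. ln (\<xi> k \<omega>))) \<theta>)" for \<theta>
    unfolding L_def by (rule char_distr_sum)
  moreover have "char (distr M borel (\<lambda>\<omega>. ln (\<xi> k \<omega>))) \<theta> =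
      step_char \<sigma> \<mu> ((r - \<mu>) / \<sigma>) \<theta> (1 / 2 ^ m)" for k \<theta>
  proof -
    have "char (distr M borel (\<lambda>\<omega>. ln (\<xi> k \<omega>))) \<theta> = (\<integral>\<omega>. iexp (\<theta> * ln (\<xi> k \<omega>)) \<partial>M)"
      unfolding char_def by (subst integral_distr) auto
    also have "\<dots> = q_up \<mu> \<sigma> r m *\<^sub>R iexp (\<theta> * ln ?u) + q_down \<mu> \<sigma> r m *\<^sub>R iexp (\<theta> * ln ?d)"
      by (rule integral_two_values[OF _ _ ud pu pd pq]) measurable
    \<comment> \<open>With h = 1 / 2^m the corrections of order 2^(-2m) become h^2, as in
      \<open>step_char\<close>.\<close>
    also have "q_up \<mu> \<sigma> r m = 1 / 2 + (r - \<mu>) / \<sigma> / 2 * (1 / 2 ^ m)"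
      by (simp add: q_up_def)
    also have "q_down \<mu> \<sigma> r m = 1 / 2 - (r - \<mu>) / \<sigma> / 2 * (1 / 2 ^ m)"
      by (simp add: q_down_def)
    also have "?u = 1 + \<sigma> * (1 / 2 ^ m) + \<mu> * (1 / 2 ^ m)\<^sup>2"
      by (simp add: up_factor_def power_divide power_mult[symmetric] mult.commute[of m])
    also have "?d = 1 - \<sigma> * (1 / 2 ^ m) + \<mu> * (1 / 2 ^ m)\<^sup>2"
      by (simp add: down_factor_def power_divide power_mult[symmetric] mult.commute[of m])
    finally show ?thesis
      by (simp only: step_char_def)
  qed
  moreover have "(\<integral>\<omega>. g (S (grid_time m n) \<omega>) \<partial>M) = (\<integral>y. g (x * exp y) \<partial>(distr M borel L))"
    if [measurable]: "g \<in> borel_measurable borel" for g :: "real \<Rightarrow> real"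
  proof -
    have "(\<integral>\<omega>. g (S (grid_time m n) \<omega>) \<partial>M) = (\<integral>\<omega>. g (x * exp (L \<omega>)) \<partial>M)"
      using S_eq[of n] by (intro integral_cong_AE) (auto simp: L_def)
    then show ?thesis
      by (subst integral_distr) auto
  qed
  ultimately show ?thesis
    by (intro that[of "distr M borel L"]) auto
qed

section \<open>Characteristic function of the Brownian log-return\<close>

lemma (in prob_space) char_normal:
  assumes "distributed M lborel X (\<lambda>y. ennreal (normal_density 0 s y))" "s > 0"
  shows "(\<integral>\<omega>. iexp (\<theta> * X \<omega>) \<partial>M) = of_real (exp (- (\<theta>\<^sup>2 * s\<^sup>2 / 2)))"
proof -
  have Z: "distributed M lborel (\<lambda>\<omega>. X \<omega> / s) std_normal_density"
    using assms normal_standard_normal_convert[of s X 0] by simp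
  then have [measurable]: "(\<lambda>\<omega>. X \<omega> / s) \<in> borel_measurable M"
    by (auto dest: distributed_measurable)
  have "distr M borel (\<lambda>\<omega>. X \<omega> / s) = std_normal_distribution"
    using distributed_distr_eq_density[OF Z] by (simp cong: distr_cong)
  \<comment> \<open>Since X = s * (X / s), the standard normal characteristic function is taken at
    theta * s.\<close>
  then have "char (distr M borel (\<lambda>\<omega>. X \<omega> / s)) (\<theta> * s) = of_real (exp (- ((\<theta> * s)\<^sup>2 / 2)))"
    by (simp add: char_std_normal_distribution)
  also have "char (distr M borel (\<lambda>\<omega>. X \<omega> / s)) (\<theta> * s) = (\<integral>\<omega>. iexp (\<theta> * X \<omega>) \<partial>M)"
    unfolding char_def using \<open>s > 0\<close> by (subst integral_distr) auto
  finally show ?thesis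
    by (simp add: power_mult_distrib)
qed

text \<open>The law of W is specified through increments over nondegenerate intervals. So tau = 0 is
  treated apart, and otherwise W tau is exchanged for W tau - W 0, which agrees with it almost
  surely.\<close>

lemma char_log_stock:
  assumes BM: "brownian_motion Q W" and "\<tau> \<ge> 0"
  shows "char (distr Q borel (\<lambda>\<omega>. a * \<tau> + \<sigma> * W \<tau> \<omega>)) \<theta> =
    exp (\<tau> *\<^sub>R Complex (- (\<theta>\<^sup>2 * \<sigma>\<^sup>2 / 2)) (\<theta> * a))"
proof -
  from BM interpret prob_space Q
    by (simp add: brownian_motion_def)
  from BM \<open>\<tau> \<ge> 0\<close> have [measurable]: "W \<tau> \<in> borel_measurable Q" "W 0 \<in> borel_measurable Q"
    by (simp_all add: brownian_motion_def)
  from BM have W0: "AE \<omega> in Q. W 0 \<omega> = 0"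
    by (simp add: brownian_motion_def)
  have W_char: "(\<integral>\<omega>. iexp ((\<theta> * \<sigma>) * W \<tau> \<omega>) \<partial>Q) = of_real (exp (- (\<theta>\<^sup>2 * \<sigma>\<^sup>2 / 2 * \<tau>)))"
  proof (cases "\<tau> = 0")
    case True
    have "(\<integral>\<omega>. iexp ((\<theta> * \<sigma>) * W 0 \<omega>) \<partial>Q) = (\<integral>\<omega>. 1 \<partial>Q)"
      using W0 by (intro integral_cong_AE) auto
    with True show ?thesis
      by (simp add: prob_space)
  next
    case False
    with \<open>\<tau> \<ge> 0\<close> have "\<tau> > 0" by simp
    with BM have "distributed Q lborel (\<lambda>\<omega>. W \<tau> \<omega> - W 0 \<omega>) (\<lambda>y. ennreal (normal_density 0 (sqrt (\<tau> - 0)) y))"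
      unfolding brownian_motion_def by blast
    from char_normal[OF this, of "\<theta> * \<sigma>"] \<open>\<tau> > 0\<close>
    have "(\<integral>\<omega>. iexp ((\<theta> * \<sigma>) * (W \<tau> \<omega> - W 0 \<omega>)) \<partial>Q) = of_real (exp (- (\<theta>\<^sup>2 * \<sigma>\<^sup>2 / 2 * \<tau>)))"
      by (simp add: power_mult_distrib field_simps)
    moreover have "(\<integral>\<omega>. iexp ((\<theta> * \<sigma>) * (W \<tau> \<omega> - W 0 \<omega>)) \<partial>Q) = (\<integral>\<omega>. iexp ((\<theta> * \<sigma>) * W \<tau> \<omega>) \<partial>Q)"
      using W0 by (intro integral_cong_AE) auto
    ultimately show ?thesis by simp
  qed
  have "char (distr Q borel (\<lambda>\<omega>. a * \<tau> + \<sigma> * W \<tau> \<omega>)) \<theta> =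
      (\<integral>\<omega>. iexp (\<theta> * (a * \<tau> + \<sigma> * W \<tau> \<omega>)) \<partial>Q)"
    unfolding char_def by (subst integral_distr) auto
  also have "\<dots> = (\<integral>\<omega>. iexp (\<theta> * a * \<tau>) * iexp ((\<theta> * \<sigma>) * W \<tau> \<omega>) \<partial>Q)"
    by (intro Bochner_Integration.integral_cong) (auto simp: exp_add[symmetric] algebra_simps)
  also have "\<dots> = iexp (\<theta> * a * \<tau>) * of_real (exp (- (\<theta>\<^sup>2 * \<sigma>\<^sup>2 / 2 * \<tau>)))"
    using W_char by simp
  also have "\<dots> = exp (\<i> * complex_of_real (\<theta> * a * \<tau>) + complex_of_real (- (\<theta>\<^sup>2 * \<sigma>\<^sup>2 / 2 * \<tau>)))"
    by (simp only: exp_add exp_of_real)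
  also have "\<i> * complex_of_real (\<theta> * a * \<tau>) + complex_of_real (- (\<theta>\<^sup>2 * \<sigma>\<^sup>2 / 2 * \<tau>)) =
      \<tau> *\<^sub>R Complex (- (\<theta>\<^sup>2 * \<sigma>\<^sup>2 / 2)) (\<theta> * a)"
    by (simp add: complex_eq_iff)
  finally show ?thesis .
qed

text \<open>The hypothesis says that both weights are nonnegative; as they sum to 1, the value is a
  convex combination of points on the unit circle.\<close>

lemma norm_step_char_le_1:
  assumes "\<bar>c * h\<bar> \<le> 1"
  shows "norm (step_char \<sigma> \<mu> c \<theta> h) \<le> 1"
proof -
  have "norm (step_char \<sigma> \<mu> c \<theta> h) \<le> \<bar>1 / 2 + c / 2 * h\<bar> + \<bar>1 / 2 - c / 2 * h\<bar>"
    unfolding step_char_def by (rule order_trans[OF norm_triangle_ineq]) simp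
  with assms show ?thesis
    by (simp add: abs_if split: if_splits)
qed

lemma tendsto_half_power_at_right: "filterlim (\<lambda>m. 1 / 2 ^ m :: real) (at_right 0) sequentially"
  by real_asymp

text \<open>In the unit disc |a^n - b^n| <= n |a - b|. Since n h^2 stays bounded, an error o(h^2)
  per step accumulates to o(1) only.\<close>

lemma step_char_power_tendsto:
  fixes \<sigma> \<mu> c \<theta> :: real and n :: "nat \<Rightarrow> nat"
  assumes "\<sigma> > 0" and n: "(\<lambda>m. real (n m) / 2 ^ (2 * m)) \<longlonglongrightarrow> \<tau>"
  defines "z \<equiv> Complex (- (\<theta>\<^sup>2 * \<sigma>\<^sup>2 / 2)) (\<theta> * (c * \<sigma> + \<mu> - \<sigma>\<^sup>2 / 2))"
  shows "(\<lambda>m. step_char \<sigma> \<mu> c \<theta> (1 / 2 ^ m) ^ n m) \<longlonglongrightarrow> exp (\<tau> *\<^sub>R z)"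
proof -
  define h :: "nat \<Rightarrow> real" where "h m = 1 / 2 ^ m" for m
  define \<psi> where "\<psi> m = step_char \<sigma> \<mu> c \<theta> (h m)" for m
  have h2: "(h m)\<^sup>2 = 1 / 2 ^ (2 * m)" for m
    by (simp add: h_def power_divide power_mult[symmetric] mult.commute)
  have h_pos: "h m > 0" for m
    by (simp add: h_def)
  have h0: "filterlim h (at_right 0) sequentially"
    unfolding h_def by (rule tendsto_half_power_at_right)
  have "(\<lambda>m. (\<psi> m - exp ((h m)\<^sup>2 *\<^sub>R z)) /\<^sub>R (h m)\<^sup>2) \<longlonglongrightarrow> 0"
    unfolding \<psi>_def z_def by (rule filterlim_compose[OF step_char_expansion[OF \<open>\<sigma> > 0\<close>] h0])
  then have "(\<lambda>m. real (n m) / 2 ^ (2 * m) * norm ((\<psi> m - exp ((h m)\<^sup>2 *\<^sub>R z)) /\<^sub>R (h m)\<^sup>2))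
      \<longlonglongrightarrow> \<tau> * norm (0 :: complex)"
    by (intro tendsto_intros n)
  also have "(\<lambda>m. real (n m) / 2 ^ (2 * m) * norm ((\<psi> m - exp ((h m)\<^sup>2 *\<^sub>R z)) /\<^sub>R (h m)\<^sup>2)) =
      (\<lambda>m. real (n m) * norm (\<psi> m - exp ((h m)\<^sup>2 *\<^sub>R z)))"
    by (simp add: h2)
  finally have bound0: "(\<lambda>m. real (n m) * norm (\<psi> m - exp ((h m)\<^sup>2 *\<^sub>R z))) \<longlonglongrightarrow> 0"
    by simp
  have "(\<lambda>m. c * h m) \<longlonglongrightarrow> c * 0"
    by (intro tendsto_intros) (use h0 in \<open>simp add: filterlim_at\<close>)
  then have "eventually (\<lambda>m. \<bar>c * h m\<bar> < 1) sequentially"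
    by (intro order_tendstoD(2)[of _ 0]) (auto intro!: tendsto_rabs_zero)
  then have "eventually (\<lambda>m. norm (\<psi> m ^ n m - exp ((h m)\<^sup>2 *\<^sub>R z) ^ n m) \<le>
      real (n m) * norm (\<psi> m - exp ((h m)\<^sup>2 *\<^sub>R z))) sequentially"
  proof eventually_elim
    case (elim m)
    show ?case
    proof (rule norm_power_diff)
      show "norm (\<psi> m) \<le> 1"
        unfolding \<psi>_def using elim by (intro norm_step_char_le_1) simp
    \<comment> \<open>The real part of z is - theta^2 sigma^2 / 2 <= 0, so the exponential has
      modulus at most 1.\<close>
    qed (simp add: z_def)
  qed
  then have diff0: "(\<lambda>m. \<psi> m ^ n m - exp ((h m)\<^sup>2 *\<^sub>R z) ^ n m) \<longlonglongrightarrow> 0"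
    by (rule Lim_null_comparison[OF _ bound0])
  have exp_power:  "exp ((real (n m) / 2 ^ (2 * m)) *\<^sub>R z) = exp ((h m)\<^sup>2 *\<^sub>R z) ^ n m" for m
    unfolding exp_of_nat_mult[symmetric] h2 by (simp add: scaleR_conv_of_real)
  have "(\<lambda>m. exp ((real (n m) / 2 ^ (2 * m)) *\<^sub>R z)) \<longlonglongrightarrow> exp (\<tau> *\<^sub>R z)"
    by (intro tendsto_intros n)
  then have "(\<lambda>m. exp ((h m)\<^sup>2 *\<^sub>R z) ^ n m) \<longlonglongrightarrow> exp (\<tau> *\<^sub>R z)"
    by (simp only: exp_power)
  from tendsto_add[OF diff0 this] show ?thesis
    by (simp add: \<psi>_def h_def)
qed

text \<open>Weak convergence of the log-returns is applied to the bounded continuous function g (x *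
  exp y).\<close>

lemma discrete_expectation_tendsto:
  fixes \<sigma> \<mu> r x \<tau> :: real and n :: "nat \<Rightarrow> nat" and g :: "real \<Rightarrow> real"
  assumes "\<sigma> > 0" "x > 0" "\<tau> \<ge> 0"
    and g_cont: "continuous_on UNIV g" and g_bdd: "\<And>y. \<bar>g y\<bar> \<le> B"
    and n: "(\<lambda>m. real (n m) / 2 ^ (2 * m)) \<longlonglongrightarrow> \<tau>"
    and chain: "\<And>m. 0 < q_up \<mu> \<sigma> r m \<Longrightarrow> q_up \<mu> \<sigma> r m < 1 \<Longrightarrow>
      binomial_chain \<mu> \<sigma> r m x (Qm m) (Sm m)"
    and BM: "brownian_motion Q W"
  shows "(\<lambda>m. \<integral>\<omega>. g (Sm m (grid_time m (n m)) \<omega>) \<partial>Qm m)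
    \<longlonglongrightarrow> (\<integral>\<omega>. g (stock_price r \<sigma> W x \<tau> \<omega>) \<partial>Q)"
proof -
  let ?c = "(r - \<mu>) / \<sigma>"
  have [measurable]: "g \<in> borel_measurable borel"
    using g_cont by (rule borel_measurable_continuous_onI)
  from BM interpret Q: prob_space Q
    by (simp add: brownian_motion_def)
  from BM \<open>\<tau> \<ge> 0\<close> have [measurable]: "W \<tau> \<in> borel_measurable Q"
    by (simp add: brownian_motion_def)
  have "(\<lambda>m. q_up \<mu> \<sigma> r m) \<longlonglongrightarrow> 1 / 2" "(\<lambda>m. up_factor \<mu> \<sigma> m) \<longlonglongrightarrow> 1" "(\<lambda>m. down_factor \<mu> \<sigma> m) \<longlonglongrightarrow> 1"
    unfolding q_up_def up_factor_def down_factor_def by real_asymp+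
  from order_tendstoD(1)[OF this(1), of 0] order_tendstoD(2)[OF this(1), of 1]
    order_tendstoD(1)[OF this(2), of 0] order_tendstoD(1)[OF this(3), of 0]
  have "eventually (\<lambda>m. 0 < q_up \<mu> \<sigma> r m \<and> q_up \<mu> \<sigma> r m < 1 \<and>
      0 < up_factor \<mu> \<sigma> m \<and> 0 < down_factor \<mu> \<sigma> m) sequentially"
    by (simp add: eventually_conj)
  then obtain m0 where m0: "\<And>m. m \<ge> m0 \<Longrightarrow> 0 < q_up \<mu> \<sigma> r m \<and> q_up \<mu> \<sigma> r m < 1 \<and>
      0 < up_factor \<mu> \<sigma> m \<and> 0 < down_factor \<mu> \<sigma> m"
    by (auto simp: eventually_sequentially)
  \<comment> \<open>Levy's theorem wants a law for every index, while the log-return is available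
    only from m0 on; hence the shift, undone at the end.\<close>
  have "\<exists>\<nu>. real_distribution \<nu> \<and>
      (\<forall>\<theta>. char \<nu> \<theta> = step_char \<sigma> \<mu> ?c \<theta> (1 / 2 ^ (m + m0)) ^ n (m + m0)) \<and>
      (\<integral>\<omega>. g (Sm (m + m0) (grid_time (m + m0) (n (m + m0))) \<omega>) \<partial>Qm (m + m0)) = (\<integral>y. g (x * exp y) \<partial>\<nu>)" for m
  proof -
    note k = m0[OF le_add2[of m0 m]]
    have "binomial_chain \<mu> \<sigma> r (m + m0) x (Qm (m + m0)) (Sm (m + m0))"
      using k by (intro chain) auto
    from this \<open>\<sigma> > 0\<close> \<open>x > 0\<close> show ?thesis
      by (rule binomial_chain_law[where n = "n (m + m0)"]) (use k in auto)
  qed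
  then obtain \<nu> where \<nu>: "\<And>m. real_distribution (\<nu> m)"
    "\<And>m \<theta>. char (\<nu> m) \<theta> = step_char \<sigma> \<mu> ?c \<theta> (1 / 2 ^ (m + m0)) ^ n (m + m0)"
    "\<And>m. (\<integral>\<omega>. g (Sm (m + m0) (grid_time (m + m0) (n (m + m0))) \<omega>) \<partial>Qm (m + m0)) = (\<integral>y. g (x * exp y) \<partial>\<nu> m)"
    by metis
  define L where "L \<omega> = (r - \<sigma>\<^sup>2 / 2) * \<tau> + \<sigma> * W \<tau> \<omega>" for \<omega>
  have [measurable]: "L \<in> borel_measurable Q"
    unfolding L_def by measurable
  have L_dist: "real_distribution (distr Q borel L)"
    by (rule Q.real_distribution_distr) measurable
  have "(\<lambda>m. char (\<nu> m) \<theta>) \<longlonglongrightarrow> char (distr Q borel L) \<theta>" for \<theta>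
    using LIMSEQ_ignore_initial_segment[OF step_char_power_tendsto[OF \<open>\<sigma> > 0\<close> n, of \<mu> ?c \<theta>], of m0] \<open>\<sigma> > 0\<close>
    unfolding L_def by (subst char_log_stock[OF BM \<open>\<tau> \<ge> 0\<close>]) (simp add: \<nu>(2))
  then have weak: "weak_conv_m \<nu> (distr Q borel L)"
    by (rule levy_continuity[OF \<nu>(1) L_dist])
  have "continuous_on UNIV (\<lambda>y. g (x * exp y))"
    by (rule continuous_on_compose2[OF g_cont]) (auto intro!: continuous_intros)
  then have "isCont (\<lambda>y. g (x * exp y)) y" for y
    by (simp add: continuous_on_eq_continuous_at)
  then have "(\<lambda>m. \<integral>y. g (x * exp y) \<partial>\<nu> m) \<longlonglongrightarrow> (\<integral>y. g (x * exp y) \<partial>(distr Q borel L))"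
    by (rule weak_conv_imp_integral_bdd_continuous_conv[OF \<nu>(1) L_dist weak]) (use g_bdd in simp)
  also have "(\<integral>y. g (x * exp y) \<partial>(distr Q borel L)) = (\<integral>\<omega>. g (stock_price r \<sigma> W x \<tau> \<omega>) \<partial>Q)"
    by (subst integral_distr) (auto simp: L_def stock_price_def)
  finally have "(\<lambda>m. \<integral>\<omega>. g (Sm (m + m0) (grid_time (m + m0) (n (m + m0))) \<omega>) \<partial>Qm (m + m0))
      \<longlonglongrightarrow> (\<integral>\<omega>. g (stock_price r \<sigma> W x \<tau> \<omega>) \<partial>Q)"
    by (simp only: \<nu>(3))
  then show ?thesis
    by (rule LIMSEQ_offset)
qed

subsection \<open>Taylor bounds and the log-transformed claim\<close>

text \<open>Dividing by z - w bounds the distance of the difference quotient from D by e z. The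
  undivided form lets errors be added up first, and the set S covers one-sided derivatives.\<close>

lemma has_real_derivative_boundI:
  fixes f :: "real \<Rightarrow> real"
  assumes bound: "\<And>z. z \<in> S \<Longrightarrow> \<bar>f z - f w - (z - w) * D\<bar> \<le> \<bar>z - w\<bar> * e z"
    and e: "(e \<longlongrightarrow> 0) (at w within S)"
  shows "(f has_real_derivative D) (at w within S)"
  unfolding has_field_derivative_iff
proof (subst Lim_null, rule Lim_null_comparison[OF _ e])
  show "\<forall>\<^sub>F z in at w within S. norm ((f z - f w) / (z - w) - D) \<le> e z"
    unfolding eventually_at_filter
  proof (intro always_eventually allI impI)
    fix z assume z: "z \<noteq> w" "z \<in> S"
    have "(f z - f w) / (z - w) - D = (f z - f w - (z - w) * D) / (z - w)"
      using z by (simp add: diff_divide_distrib)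
    then have "norm ((f z - f w) / (z - w) - D) = \<bar>f z - f w - (z - w) * D\<bar> / \<bar>z - w\<bar>"
      by (simp add: abs_divide)
    also have "\<dots> \<le> e z"
      using bound[OF z(2)] z(1) by (simp add: divide_le_eq mult.commute)
    finally show "norm ((f z - f w) / (z - w) - D) \<le> e z" .
  qed
qed

text \<open>This and the next two bounds instantiate one Taylor theorem with remainder B |z -
  w|^(n+1) / n!. A list indexed by position serves as the sequence of derivatives.\<close>

lemma taylor0_bound:
  fixes G :: "real \<Rightarrow> real"
  assumes "\<And>y. (G has_real_derivative G1 y) (at y)" "\<And>y. \<bar>G1 y\<bar> \<le> B"
  shows "\<bar>G z - G w\<bar> \<le> B * \<bar>z - w\<bar>"
  using field_Taylor[of UNIV 0 "\<lambda>i. [G, G1] ! i" B w z] assms by simp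

lemma taylor1_bound:
  fixes G :: "real \<Rightarrow> real"
  assumes "\<And>y. (G has_real_derivative G1 y) (at y)" "\<And>y. (G1 has_real_derivative G2 y) (at y)"
    and "\<And>y. \<bar>G2 y\<bar> \<le> B"
  shows "\<bar>G z - G w - G1 w * (z - w)\<bar> \<le> B * \<bar>z - w\<bar>\<^sup>2"
proof -
  have "\<bar>G z - (\<Sum>i\<le>1. ([G, G1, G2] ! i) w * (z - w) ^ i / fact i)\<bar> \<le> B * norm (z - w) ^ Suc 1 / fact 1"
    using field_Taylor[of UNIV 1 "\<lambda>i. [G, G1, G2] ! i" B w z] assms
    by (simp add: le_Suc_eq split: nat.split) force
  then show ?thesis
    by (simp add: power2_eq_square diff_diff_eq)
qed


lemma taylor2_bound:
  fixes G :: "real \<Rightarrow> real"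
  assumes "\<And>y. (G has_real_derivative G1 y) (at y)" "\<And>y. (G1 has_real_derivative G2 y) (at y)"
    and "\<And>y. (G2 has_real_derivative G3 y) (at y)" and "\<And>y. \<bar>G3 y\<bar> \<le> B"
  shows "\<bar>G z - G w - G1 w * (z - w) - G2 w * (z - w)\<^sup>2 / 2\<bar> \<le> B * \<bar>z - w\<bar> ^ 3"
proof -
  have "B \<ge> 0"
    using assms(4)[of 0] by linarith
  have D: "(([G, G1, G2, G3] ! i) has_field_derivative ([G, G1, G2, G3] ! Suc i) y) (at y)"
    if "i \<le> 2" for i y
  proof -
    from that consider "i = 0" | "i = 1" | "i = 2" by linarith
    then show ?thesis by cases (use assms in simp_all)
  qed
  have "\<bar>G z - (\<Sum>i\<le>2. ([G, G1, G2, G3] ! i) w * (z - w) ^ i / fact i)\<bar> \<le> B * norm (z - w) ^ Suc 2 / fact 2"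
    using field_Taylor[of UNIV 2 "\<lambda>i. [G, G1, G2, G3] ! i" B w z] D assms(4) by simp
  \<comment> \<open>The factor 1 / 2! is dropped; only the order of the remainder matters.\<close>
  also have "\<dots> \<le> B * \<bar>z - w\<bar> ^ 3"
  proof -
    have "B * \<bar>z - w\<bar> ^ 3 \<ge> 0"
      using \<open>B \<ge> 0\<close> by simp
    then show ?thesis
      by (simp add: eval_nat_numeral)
  qed
  finally show ?thesis
    by (simp add: numeral_2_eq_2 diff_diff_eq add.assoc)
qed

(* The library version integral_abs_bound_integral is restricted to measures on Euclidean spaces. *)
lemma abs_integral_le:
  fixes f h :: "'a \<Rightarrow> real"
  assumes "integrable M f" "integrable M h" "\<And>x. x \<in> space M \<Longrightarrow> \<bar>f x\<bar> \<le> h x"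
  shows "\<bar>\<integral>x. f x \<partial>M\<bar> \<le> (\<integral>x. h x \<partial>M)"
  by (rule order_trans[OF integral_abs_bound]) (use assms in \<open>auto intro!: integral_mono\<close>)

text \<open>A global bound on the second derivative makes the Taylor remainder quadratic uniformly
  in the sample point, so it can be integrated directly, in place of a dominated convergence
  argument.\<close>

lemma (in prob_space) has_derivative_expectation_shift:
  fixes G :: "real \<Rightarrow> real"
  assumes [measurable]: "random_variable borel X"
    and D: "\<And>y. (G has_real_derivative G1 y) (at y)" "\<And>y. (G1 has_real_derivative G2 y) (at y)"
    and bdd: "\<And>y. \<bar>G y\<bar> \<le> B" "\<And>y. \<bar>G1 y\<bar> \<le> B" "\<And>y. \<bar>G2 y\<bar> \<le> B"
  shows "((\<lambda>y. \<integral>\<omega>. G (y + X \<omega>) \<partial>M) has_real_derivative (\<integral>\<omega>. G1 (y + X \<omega>) \<partial>M)) (at y)"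
proof (rule has_real_derivative_boundI)
  have [measurable]: "G \<in> borel_measurable borel" "G1 \<in> borel_measurable borel"
    using D by (auto intro!: borel_measurable_continuous_onI DERIV_continuous_on)
  have int: "integrable M (\<lambda>\<omega>. G (z + X \<omega>))" "integrable M (\<lambda>\<omega>. G1 (z + X \<omega>))" for z
    using bdd by (auto intro!: integrable_const_bound[of _ B])
  fix z
  have "\<bar>(\<integral>\<omega>. G (z + X \<omega>) \<partial>M) - (\<integral>\<omega>. G (y + X \<omega>) \<partial>M) - (z - y) * (\<integral>\<omega>. G1 (y + X \<omega>) \<partial>M)\<bar> =
      \<bar>\<integral>\<omega>. G (z + X \<omega>) - G (y + X \<omega>) - G1 (y + X \<omega>) * (z - y) \<partial>M\<bar>"
    using int by (simp add: mult.commute)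
  also have "\<dots> \<le> (\<integral>\<omega>. B * \<bar>z - y\<bar>\<^sup>2 \<partial>M)"
  proof (rule abs_integral_le)
    show "\<bar>G (z + X \<omega>) - G (y + X \<omega>) - G1 (y + X \<omega>) * (z - y)\<bar> \<le> B * \<bar>z - y\<bar>\<^sup>2" for \<omega>
      using taylor1_bound[OF D bdd(3), of "z + X \<omega>" "y + X \<omega>"] by simp
  qed (use int in simp_all)
  also have "\<dots> = \<bar>z - y\<bar> * (B * \<bar>z - y\<bar>)"
    by (simp add: prob_space power2_eq_square del: power2_abs abs_mult_self_eq)
  finally show "\<bar>(\<integral>\<omega>. G (z + X \<omega>) \<partial>M) - (\<integral>\<omega>. G (y + X \<omega>) \<partial>M) - (z - y) * (\<integral>\<omega>. G1 (y + X \<omega>) \<partial>M)\<bar>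
      \<le> \<bar>z - y\<bar> * (B * \<bar>z - y\<bar>)" .
next
  show "((\<lambda>z. B * \<bar>z - y\<bar>) \<longlongrightarrow> 0) (at y)"
    by (rule tendsto_eq_intros refl | simp)+
qed

section \<open>Bounded derivatives of the claim in the log variable\<close>

lemma bounded_of_compact_support:
  fixes k :: "real \<Rightarrow> real"
  assumes "continuous_on UNIV k" "compact K" "\<And>v. v \<notin> K \<Longrightarrow> k v = 0"
  obtains B where "\<And>v. \<bar>k v\<bar> \<le> B"
proof -
  have "compact (k ` K)"
    using assms continuous_on_subset by (intro compact_continuous_image) blast+
  then obtain C where "\<And>v. v \<in> K \<Longrightarrow> \<bar>k v\<bar> \<le> C"
    using compact_imp_bounded[of "k ` K"] unfolding bounded_iff by auto
  \<comment> \<open>The maximum with 0 serves the points outside K; C may be negative if K is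
    empty.\<close>
  with assms(3) have "\<bar>k v\<bar> \<le> max C 0" for v
    by (cases "v \<in> K") (force simp: le_max_iff_disj)+
  then show ?thesis by (rule that)
qed

lemma higher_deriv_zero_on_open:
  fixes g :: "real \<Rightarrow> real"
  assumes "open U" "\<And>v. v \<in> U \<Longrightarrow> g v = 0" "v \<in> U"
  shows "(deriv ^^ k) g v = 0"
  using assms(3)
proof (induction k arbitrary: v)
  case (Suc k)
  have "eventually (\<lambda>w. (deriv ^^ k) g w = 0) (nhds v)"
    using Suc assms(1) by (auto intro!: eventually_nhds_in_open[THEN eventually_mono])
  then have "deriv ((deriv ^^ k) g) v = deriv (\<lambda>_. 0) v"
    by (rule deriv_cong_ev) simp
  then show ?case by simp
qed (use assms(2) in simp)

text \<open>The derivatives of g (exp y) are combinations of v^k g^(k)(v) at v = exp y. The powers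
  of v alone are unbounded, but each product is continuous and vanishes off a compact set. The
  recursion (\<open>P k\<close>)' = k \<open>P k\<close> + \<open>P (Suc k)\<close> generates all of
  them.\<close>

lemma C3_compact_support_log_derivatives:
  assumes "C3_compact_support g"
  obtains G1 G2 G3 :: "real \<Rightarrow> real" and B where
    "\<And>y. ((\<lambda>y. g (exp y)) has_real_derivative G1 y) (at y)"
    "\<And>y. (G1 has_real_derivative G2 y) (at y)"
    "\<And>y. (G2 has_real_derivative G3 y) (at y)"
    "\<And>y. \<bar>g (exp y)\<bar> \<le> B" "\<And>y. \<bar>G1 y\<bar> \<le> B" "\<And>y. \<bar>G2 y\<bar> \<le> B" "\<And>y. \<bar>G3 y\<bar> \<le> B"
proof -
  define d where "d k = (deriv ^^ k) g" for k
  define K where "K = closure {x. g x \<noteq> 0}"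
  have K: "compact K"
    using assms by (simp add: K_def C3_compact_support_def)
  have D: "(d k has_real_derivative d (Suc k) v) (at v)" if "k < 3" for k v
    using assms that by (auto simp: C3_compact_support_def d_def field_differentiable_derivI
        real_differentiable_def field_differentiable_def DERIV_deriv_iff_real_differentiable)
  have cont: "continuous_on UNIV (d k)" if "k \<le> 3" for k
  proof (cases "k = 3")
    case True
    then show ?thesis using assms by (simp add: d_def C3_compact_support_def)
  next
    case False
    with that have "k < 3" by simp
    with D show ?thesis by (intro DERIV_continuous_on) blast
  qed
  have zero: "d k v = 0" if "v \<notin> K" for k v
    unfolding d_def
  proof (rule higher_deriv_zero_on_open[of "- K"])
    show "g w = 0" if "w \<in> - K" for w
      using that closure_subset[of "{x. g x \<noteq> 0}"] by (auto simp: K_def)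
  qed (use that in \<open>auto simp: K_def\<close>)
  have "\<exists>C. \<forall>v. \<bar>v ^ k * d k v\<bar> \<le> C" if "k \<le> 3" for k
    by (rule bounded_of_compact_support[of "\<lambda>v. v ^ k * d k v" K])
      (use K zero cont[OF that] in \<open>auto intro!: continuous_intros\<close>)
  then obtain C where C: "\<And>k v. k \<le> 3 \<Longrightarrow> \<bar>v ^ k * d k v\<bar> \<le> C k"
    by metis
  define P where "P k y = exp y ^ k * d k (exp y)" for k y
  have P_bdd: "\<bar>P k y\<bar> \<le> C k" if "k \<le> 3" for k y
    unfolding P_def by (rule C[OF that])
  have P_D: "(P k has_real_derivative real k * P k y + P (Suc k) y) (at y)" if "k < 3" for k y
  proof -
    have "((\<lambda>y. d k (exp y)) has_real_derivative d (Suc k) (exp y) * exp y) (at y)"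
      by (rule DERIV_chain2[OF D[OF that]]) (rule DERIV_exp)
    moreover have "((\<lambda>y. exp y ^ k) has_real_derivative real k * exp y ^ k) (at y)"
      unfolding exp_of_nat_mult[symmetric] by (auto intro!: derivative_eq_intros)
    ultimately have "((\<lambda>y. exp y ^ k * d k (exp y)) has_real_derivative
        real k * exp y ^ k * d k (exp y) + d (Suc k) (exp y) * exp y * exp y ^ k) (at y)"
      by (intro DERIV_mult)
    then show ?thesis
      by (simp add: P_def[abs_def] algebra_simps)
  qed
  have G: "(\<lambda>y. g (exp y)) = P 0"
    by (auto simp: P_def d_def)
  note D0 = P_D[of 0, simplified] and D1 = P_D[of 1, simplified] and D2 = P_D[of 2, simplified]
  show ?thesis
  \<comment> \<open>The coefficients 1; 1, 1; 1, 3, 1 are Stirling numbers of the second kind. The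
    constant weighs the bound of each \<open>P k\<close> with the largest coefficient it receives,
    \<open>C 0\<close> covering g itself.\<close>
  proof (rule that[of "P 1" "\<lambda>y. P 1 y + P 2 y" "\<lambda>y. P 1 y + 3 * P 2 y + P 3 y" "C 0 + C 1 + 3 * C 2 + C 3"])
    fix y
    have "C 0 \<ge> 0" "C 1 \<ge> 0" "C 2 \<ge> 0" "C 3 \<ge> 0"
      using P_bdd[of 0 y] P_bdd[of 1 y] P_bdd[of 2 y] P_bdd[of 3 y] by linarith+
    then show "\<bar>g (exp y)\<bar> \<le> C 0 + C 1 + 3 * C 2 + C 3" "\<bar>P 1 y\<bar> \<le> C 0 + C 1 + 3 * C 2 + C 3"
      "\<bar>P 1 y + P 2 y\<bar> \<le> C 0 + C 1 + 3 * C 2 + C 3" "\<bar>P 1 y + 3 * P 2 y + P 3 y\<bar> \<le> C 0 + C 1 + 3 * C 2 + C 3"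
      unfolding fun_cong[OF G]
      using P_bdd[of 0 y] P_bdd[of 1 y] P_bdd[of 2 y] P_bdd[of 3 y] by linarith+
    show "((\<lambda>y. g (exp y)) has_real_derivative P 1 y) (at y)"
      unfolding G using D0[of y] by simp
    show "(P 1 has_real_derivative P 1 y + P 2 y) (at y)"
      using D1[of y] by (simp add: numeral_2_eq_2)
    show "((\<lambda>y. P 1 y + P 2 y) has_real_derivative P 1 y + 3 * P 2 y + P 3 y) (at y)"
      using DERIV_add[OF D1[of y] D2[of y]] by (simp add: numeral_2_eq_2 numeral_3_eq_3 algebra_simps)
  qed
qed

subsection \<open>Brownian increments and the time derivative\<close>

lemma (in prob_space) normal_increment_moments:
  assumes D: "distributed M lborel N (\<lambda>y. ennreal (normal_density 0 (sqrt \<delta>) y))" and "\<delta> > 0"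
  shows "integrable M N" "(\<integral>\<omega>. N \<omega> \<partial>M) = 0"
    and "integrable M (\<lambda>\<omega>. (N \<omega>)\<^sup>2)" "(\<integral>\<omega>. (N \<omega>)\<^sup>2 \<partial>M) = \<delta>"
    and "integrable M (\<lambda>\<omega>. \<bar>N \<omega>\<bar> ^ 3)" "(\<integral>\<omega>. \<bar>N \<omega>\<bar> ^ 3 \<partial>M) \<le> 2 * \<delta> * sqrt \<delta>"
    and "(\<integral>\<omega>. \<bar>N \<omega>\<bar> \<partial>M) \<le> sqrt \<delta>"
proof -
  have s: "sqrt \<delta> > 0"
    using \<open>\<delta> > 0\<close> by simp
  \<comment> \<open>This is the factor in the odd absolute moments of a centred normal law.\<close>
  have c: "sqrt (2 / pi) \<le> 1"
    using pi_ge_two by simp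
  have int: "integrable M (\<lambda>\<omega>. p (N \<omega>)) \<longleftrightarrow> integrable lborel (\<lambda>y. normal_density 0 (sqrt \<delta>) y * p y)"
    if "p \<in> borel_measurable borel" for p :: "real \<Rightarrow> real"
    using distributed_integrable[OF D, of p] that by simp
  have val: "(\<integral>\<omega>. p (N \<omega>) \<partial>M) = (\<integral>y. normal_density 0 (sqrt \<delta>) y * p y \<partial>lborel)"
    if "p \<in> borel_measurable borel" for p :: "real \<Rightarrow> real"
    using distributed_integral[OF D, of p] that by simp
  note I = integrable_normal_moment[OF s, of 0] integrable_normal_moment_abs[OF s, of 0]
  show "integrable M N"
    using int[of "\<lambda>y. y"] I(1)[of 1] by simp
  show "(\<integral>\<omega>. N \<omega> \<partial>M) = 0"
    using val[of "\<lambda>y. y"] integral_normal_moment_odd[OF s, of 0 0] by simp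
  show "integrable M (\<lambda>\<omega>. (N \<omega>)\<^sup>2)"
    using int[of "\<lambda>y. y\<^sup>2"] I(1)[of 2] by simp
  show "(\<integral>\<omega>. (N \<omega>)\<^sup>2 \<partial>M) = \<delta>"
    using val[of "\<lambda>y. y\<^sup>2"] integral_normal_moment_even[OF s, of 0 1] \<open>\<delta> > 0\<close> by simp
  show "integrable M (\<lambda>\<omega>. \<bar>N \<omega>\<bar> ^ 3)"
    using int[of "\<lambda>y. \<bar>y\<bar> ^ 3"] I(2)[of 3] by simp
  have "(\<integral>\<omega>. \<bar>N \<omega>\<bar> ^ 3 \<partial>M) = 2 * sqrt \<delta> ^ 3 * sqrt (2 / pi)"
    using val[of "\<lambda>y. \<bar>y\<bar> ^ 3"] integral_normal_moment_abs_odd[OF s, of 0 1] by (simp add: numeral_3_eq_3)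
  also have "\<dots> \<le> 2 * sqrt \<delta> ^ 3 * 1"
    using c \<open>\<delta> > 0\<close> by (intro mult_left_mono) auto
  also have "\<dots> = 2 * \<delta> * sqrt \<delta>"
    using \<open>\<delta> > 0\<close> by (simp add: power3_eq_cube)
  finally show "(\<integral>\<omega>. \<bar>N \<omega>\<bar> ^ 3 \<partial>M) \<le> 2 * \<delta> * sqrt \<delta>" .
  have "(\<integral>\<omega>. \<bar>N \<omega>\<bar> \<partial>M) = sqrt \<delta> * sqrt (2 / pi)"
    using val[of "\<lambda>y. \<bar>y\<bar>"] integral_normal_moment_abs_odd[OF s, of 0 0] by simp
  also have "\<dots> \<le> sqrt \<delta> * 1"
    using c \<open>\<delta> > 0\<close> by (intro mult_left_mono) auto
  finally show "(\<integral>\<omega>. \<bar>N \<omega>\<bar> \<partial>M) \<le> sqrt \<delta>" by simp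
qed

text \<open>Up to a null set W s is itself an increment, from time 0, so independence of the
  increments along 0, s, t applies.\<close>

lemma brownian_increment_expectation:
  fixes \<phi> p :: "real \<Rightarrow> real"
  assumes BM: "brownian_motion Q W" and st: "0 \<le> s" "s < t"
    and [measurable]: "\<phi> \<in> borel_measurable borel" and bdd: "\<And>y. \<bar>\<phi> y\<bar> \<le> B"
    and [measurable]: "p \<in> borel_measurable borel" and int: "integrable Q (\<lambda>\<omega>. p (W t \<omega> - W s \<omega>))"
  shows "integrable Q (\<lambda>\<omega>. \<phi> (W s \<omega>) * p (W t \<omega> - W s \<omega>))"
    and "(\<integral>\<omega>. \<phi> (W s \<omega>) * p (W t \<omega> - W s \<omega>) \<partial>Q) =
      (\<integral>\<omega>. \<phi> (W s \<omega>) \<partial>Q) * (\<integral>\<omega>. p (W t \<omega> - W s \<omega>) \<partial>Q)"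
proof -
  from BM interpret prob_space Q
    by (simp add: brownian_motion_def)
  from BM st have [measurable]: "W 0 \<in> borel_measurable Q" "W s \<in> borel_measurable Q" "W t \<in> borel_measurable Q"
    by (simp_all add: brownian_motion_def)
  from BM have W0: "AE \<omega> in Q. W 0 \<omega> = 0"
    by (simp add: brownian_motion_def)
  \<comment> \<open>For s = 0 the first two times coincide, which a nondecreasing sequence permits.
    Only the two increments with index below 2 are used.\<close>
  define \<tau> :: "nat \<Rightarrow> real" where "\<tau> i = (if i = 0 then 0 else if i = 1 then s else t)" for i
  have "0 \<le> \<tau> 0 \<and> (\<forall>i<2. \<tau> i \<le> \<tau> (Suc i))"
    using st by (auto simp: \<tau>_def)
  with BM have "indep_vars (\<lambda>_. borel) (\<lambda>i \<omega>. W (\<tau> (Suc i)) \<omega> - W (\<tau> i) \<omega>) {..<2}"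
    unfolding brownian_motion_def by blast
  \<comment> \<open>Index 0 carries \<phi> and index 1 carries p, so that the two factors form one
    independent family.\<close>
  then have indep: "indep_vars (\<lambda>_. borel)
      (\<lambda>i \<omega>. (if i = 0 then \<phi> else p) (W (\<tau> (Suc i)) \<omega> - W (\<tau> i) \<omega>)) {..<2}"
    by (rule indep_vars_compose2) simp
  have int': "integrable Q (\<lambda>\<omega>. (if i = 0 then \<phi> else p) (W (\<tau> (Suc i)) \<omega> - W (\<tau> i) \<omega>))"
    if "i \<in> {..<2}" for i
    using that int bdd by (auto simp: \<tau>_def intro!: integrable_const_bound[of _ B])
  have two: "{..<2} = {0, 1 :: nat}"
    by auto
  have ae: "AE \<omega> in Q. \<phi> (W s \<omega> - W 0 \<omega>) * p (W t \<omega> - W s \<omega>) = \<phi> (W s \<omega>) * p (W t \<omega> - W s \<omega>)"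
    and ae': "AE \<omega> in Q. \<phi> (W s \<omega> - W 0 \<omega>) = \<phi> (W s \<omega>)"
    using W0 by (eventually_elim; simp)+
  have "integrable Q (\<lambda>\<omega>. \<phi> (W s \<omega> - W 0 \<omega>) * p (W t \<omega> - W s \<omega>))"
    using indep_vars_integrable[OF _ indep int'] by (simp add: two \<tau>_def)
  then show "integrable Q (\<lambda>\<omega>. \<phi> (W s \<omega>) * p (W t \<omega> - W s \<omega>))"
    by (subst (asm) integrable_cong_AE[OF _ _ ae]) measurable
  have "(\<integral>\<omega>. \<phi> (W s \<omega> - W 0 \<omega>) * p (W t \<omega> - W s \<omega>) \<partial>Q) =
      (\<integral>\<omega>. \<phi> (W s \<omega> - W 0 \<omega>) \<partial>Q) * (\<integral>\<omega>. p (W t \<omega> - W s \<omega>) \<partial>Q)"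
    using indep_vars_lebesgue_integral[OF _ indep int'] by (simp add: two \<tau>_def)
  moreover have "(\<integral>\<omega>. \<phi> (W s \<omega> - W 0 \<omega>) * p (W t \<omega> - W s \<omega>) \<partial>Q) = (\<integral>\<omega>. \<phi> (W s \<omega>) * p (W t \<omega> - W s \<omega>) \<partial>Q)"
    by (rule integral_cong_AE[OF _ _ ae]) measurable
  moreover have "(\<integral>\<omega>. \<phi> (W s \<omega> - W 0 \<omega>) \<partial>Q) = (\<integral>\<omega>. \<phi> (W s \<omega>) \<partial>Q)"
    by (rule integral_cong_AE[OF _ _ ae']) measurable
  ultimately show "(\<integral>\<omega>. \<phi> (W s \<omega>) * p (W t \<omega> - W s \<omega>) \<partial>Q) =
      (\<integral>\<omega>. \<phi> (W s \<omega>) \<partial>Q) * (\<integral>\<omega>. p (W t \<omega> - W s \<omega>) \<partial>Q)"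
    by simp
qed

text \<open>Separates the drift from the noise in the cubic remainder, by p + q <= 2 max p
  q.\<close>

lemma power3_sum_le:
  fixes p q :: real
  assumes "p \<ge> 0" "q \<ge> 0"
  shows "(p + q) ^ 3 \<le> 8 * (p ^ 3 + q ^ 3)"
proof -
  have "(p + q) ^ 3 \<le> (2 * max p q) ^ 3"
    using assms by (intro power_mono) auto
  also have "\<dots> = 8 * max p q ^ 3"
    by (simp add: power_mult_distrib)
  also have "max p q ^ 3 \<le> p ^ 3 + q ^ 3"
    using assms by (simp add: max_def)
  finally show ?thesis by simp
qed

text \<open>For a = r - sigma^2/2, Y is the logarithm of the price started from exp y. The bounds
  below are free of y, and the bracketing y + (...) matches the shift used for the derivative in
  y.\<close>

context
  fixes Q :: "'b measure" and W :: "real \<Rightarrow> 'b \<Rightarrow> real" and a \<sigma> y :: real and Y :: "real \<Rightarrow> 'b \<Rightarrow> real"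
  assumes BM: "brownian_motion Q W"
  defines "Y \<equiv> \<lambda>t \<omega>. y + (a * t + \<sigma> * W t \<omega>)"
begin

interpretation prob_space Q
  using BM by (simp add: brownian_motion_def)

lemma W_measurable: "t \<ge> 0 \<Longrightarrow> W t \<in> borel_measurable Q"
  using BM by (simp add: brownian_motion_def)

lemma W_increment:
  "0 \<le> s \<Longrightarrow> s < t \<Longrightarrow>
    distributed Q lborel (\<lambda>\<omega>. W t \<omega> - W s \<omega>) (\<lambda>y. ennreal (normal_density 0 (sqrt (t - s)) y))"
  using BM by (simp add: brownian_motion_def)

lemma Y_measurable: "t \<ge> 0 \<Longrightarrow> Y t \<in> borel_measurable Q"
  using W_measurable unfolding Y_def by simp

lemma integrable_bounded_Y:
  fixes \<phi> :: "real \<Rightarrow> real"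
  assumes [measurable]: "\<phi> \<in> borel_measurable borel" and "\<And>v. \<bar>\<phi> v\<bar> \<le> B" and "t \<ge> 0"
  shows "integrable Q (\<lambda>\<omega>. \<phi> (Y t \<omega>))"
proof (rule integrable_const_bound[of _ B])
  show "(\<lambda>\<omega>. \<phi> (Y t \<omega>)) \<in> borel_measurable Q"
    using measurable_compose[OF Y_measurable[OF assms(3)] assms(1)] .
qed (use assms(2) in simp)

text \<open>A Lipschitz function meets E |W t - W s| <= sqrt (t - s). Applied to G1 and G2, this
  gives a modulus of continuity for the time derivative.\<close>

lemma expectation_Y_continuity:
  fixes \<phi> :: "real \<Rightarrow> real"
  assumes st: "0 \<le> s" "s < t"
    and D: "\<And>v. (\<phi> has_real_derivative \<phi>' v) (at v)"
    and bdd: "\<And>v. \<bar>\<phi> v\<bar> \<le> B" "\<And>v. \<bar>\<phi>' v\<bar> \<le> B"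
  shows "\<bar>(\<integral>\<omega>. \<phi> (Y t \<omega>) \<partial>Q) - (\<integral>\<omega>. \<phi> (Y s \<omega>) \<partial>Q)\<bar> \<le>
    B * (\<bar>a\<bar> * (t - s) + \<bar>\<sigma>\<bar> * sqrt (t - s))"
proof -
  note N = normal_increment_moments[OF W_increment[OF st]]
  have "B \<ge> 0"
    using bdd(1)[of 0] by linarith
  have [measurable]: "\<phi> \<in> borel_measurable borel"
    using D by (auto intro!: borel_measurable_continuous_onI DERIV_continuous_on)
  have int: "integrable Q (\<lambda>\<omega>. \<phi> (Y t \<omega>))" "integrable Q (\<lambda>\<omega>. \<phi> (Y s \<omega>))"
    using st bdd by (auto intro!: integrable_bounded_Y)
  have "\<bar>(\<integral>\<omega>. \<phi> (Y t \<omega>) \<partial>Q) - (\<integral>\<omega>. \<phi> (Y s \<omega>) \<partial>Q)\<bar> = \<bar>\<integral>\<omega>. \<phi> (Y t \<omega>) - \<phi> (Y s \<omega>) \<partial>Q\<bar>"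
    using int by simp
  also have "\<dots> \<le> (\<integral>\<omega>. B * (\<bar>a\<bar> * (t - s) + \<bar>\<sigma>\<bar> * \<bar>W t \<omega> - W s \<omega>\<bar>) \<partial>Q)"
  proof (rule abs_integral_le)
    fix \<omega>
    have "\<bar>\<phi> (Y t \<omega>) - \<phi> (Y s \<omega>)\<bar> \<le> B * \<bar>Y t \<omega> - Y s \<omega>\<bar>"
      by (rule taylor0_bound[OF D bdd(2)])
    also have "Y t \<omega> - Y s \<omega> = a * (t - s) + \<sigma> * (W t \<omega> - W s \<omega>)"
      by (simp add: Y_def algebra_simps)
    also have "\<bar>\<dots>\<bar> \<le> \<bar>a\<bar> * (t - s) + \<bar>\<sigma>\<bar> * \<bar>W t \<omega> - W s \<omega>\<bar>"
      using st by (intro order_trans[OF abs_triangle_ineq]) (simp add: abs_mult)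
    finally show "\<bar>\<phi> (Y t \<omega>) - \<phi> (Y s \<omega>)\<bar> \<le> B * (\<bar>a\<bar> * (t - s) + \<bar>\<sigma>\<bar> * \<bar>W t \<omega> - W s \<omega>\<bar>)"
      using \<open>B \<ge> 0\<close> by (simp add: mult_left_mono)
  qed (use int N(1) st in auto)
  also have "\<dots> = B * (\<bar>a\<bar> * (t - s) + \<bar>\<sigma>\<bar> * (\<integral>\<omega>. \<bar>W t \<omega> - W s \<omega>\<bar> \<partial>Q))"
    using N(1) st by (simp add: prob_space)
  also have "\<dots> \<le> B * (\<bar>a\<bar> * (t - s) + \<bar>\<sigma>\<bar> * sqrt (t - s))"
    using \<open>B \<ge> 0\<close> N(7) st by (intro mult_left_mono add_left_mono) auto
  finally show ?thesis .
qed

text \<open>The increment \<open>\<Delta>\<close> of Y is independent of Y s, with mean a delta and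
  second moment sigma^2 delta + a^2 delta^2, so the first two Taylor terms produce the generator of
  Y. The error depends on s and t only through delta.\<close>

lemma expectation_Y_expansion:
  fixes G G1 G2 G3 :: "real \<Rightarrow> real"
  assumes st: "0 \<le> s" "s < t"
    and D: "\<And>v. (G has_real_derivative G1 v) (at v)" "\<And>v. (G1 has_real_derivative G2 v) (at v)"
      "\<And>v. (G2 has_real_derivative G3 v) (at v)"
    and bdd: "\<And>v. \<bar>G v\<bar> \<le> B" "\<And>v. \<bar>G1 v\<bar> \<le> B" "\<And>v. \<bar>G2 v\<bar> \<le> B" "\<And>v. \<bar>G3 v\<bar> \<le> B"
  defines "\<delta> \<equiv> t - s"
  shows "\<bar>(\<integral>\<omega>. G (Y t \<omega>) \<partial>Q) - (\<integral>\<omega>. G (Y s \<omega>) \<partial>Q) -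
      \<delta> * (a * (\<integral>\<omega>. G1 (Y s \<omega>) \<partial>Q) + \<sigma>\<^sup>2 / 2 * (\<integral>\<omega>. G2 (Y s \<omega>) \<partial>Q))\<bar>
    \<le> \<delta> * (B * (a\<^sup>2 * \<delta> + 8 * \<bar>a\<bar> ^ 3 * \<delta>\<^sup>2 + 16 * \<bar>\<sigma>\<bar> ^ 3 * sqrt \<delta>))"
proof -
  define N where "N \<omega> = W t \<omega> - W s \<omega>" for \<omega>
  define \<Delta> where "\<Delta> \<omega> = a * \<delta> + \<sigma> * N \<omega>" for \<omega>
  have "\<delta> > 0" and t: "t \<ge> 0"
    using st by (simp_all add: \<delta>_def)
  note N = normal_increment_moments[OF W_increment[OF st], folded N_def \<delta>_def, OF \<open>\<delta> > 0\<close>]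
  have "B \<ge> 0"
    using bdd(1)[of 0] by linarith
  have [measurable]: "G \<in> borel_measurable borel" "G1 \<in> borel_measurable borel" "G2 \<in> borel_measurable borel"
    using D by (auto intro!: borel_measurable_continuous_onI DERIV_continuous_on)
  have [measurable]: "N \<in> borel_measurable Q" "\<Delta> \<in> borel_measurable Q"
    using W_measurable[OF st(1)] W_measurable[OF t] unfolding N_def \<Delta>_def by measurable
  have sq: "(a * \<delta> + \<sigma> * n)\<^sup>2 = a\<^sup>2 * \<delta>\<^sup>2 + 2 * a * \<delta> * \<sigma> * n + \<sigma>\<^sup>2 * n\<^sup>2" for n
    by (simp add: power2_eq_square algebra_simps)
  have E1: "integrable Q \<Delta>" "(\<integral>\<omega>. \<Delta> \<omega> \<partial>Q) = a * \<delta>"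
    using N(1,2) by (simp_all add: \<Delta>_def[abs_def] prob_space)
  have E2: "integrable Q (\<lambda>\<omega>. (\<Delta> \<omega>)\<^sup>2)" "(\<integral>\<omega>. (\<Delta> \<omega>)\<^sup>2 \<partial>Q) = a\<^sup>2 * \<delta>\<^sup>2 + \<sigma>\<^sup>2 * \<delta>"
    using N(1-4) by (simp_all add: \<Delta>_def sq prob_space)
  have I: "integrable Q (\<lambda>\<omega>. G (Y t \<omega>))" "integrable Q (\<lambda>\<omega>. G (Y s \<omega>))" "integrable Q (\<lambda>\<omega>. G2 (Y s \<omega>))"
    using st t bdd by (auto intro!: integrable_bounded_Y)
  have I1: "integrable Q (\<lambda>\<omega>. G1 (Y s \<omega>) * \<Delta> \<omega>)" "(\<integral>\<omega>. G1 (Y s \<omega>) * \<Delta> \<omega> \<partial>Q) = (\<integral>\<omega>. G1 (Y s \<omega>) \<partial>Q) * (a * \<delta>)"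
    using brownian_increment_expectation[OF BM st, of "\<lambda>w. G1 (y + (a * s + \<sigma> * w))" B "\<lambda>n. a * \<delta> + \<sigma> * n"] E1 bdd(2)
    by (simp_all add: \<Delta>_def[abs_def] N_def[abs_def] Y_def)
  have I2: "integrable Q (\<lambda>\<omega>. G2 (Y s \<omega>) * (\<Delta> \<omega>)\<^sup>2)"
    "(\<integral>\<omega>. G2 (Y s \<omega>) * (\<Delta> \<omega>)\<^sup>2 \<partial>Q) = (\<integral>\<omega>. G2 (Y s \<omega>) \<partial>Q) * (a\<^sup>2 * \<delta>\<^sup>2 + \<sigma>\<^sup>2 * \<delta>)"
    using brownian_increment_expectation[OF BM st, of "\<lambda>w. G2 (y + (a * s + \<sigma> * w))" B "\<lambda>n. (a * \<delta> + \<sigma> * n)\<^sup>2"] E2 bdd(3)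
    by (simp_all add: \<Delta>_def[abs_def] N_def[abs_def] Y_def)
  define R where "R \<omega> = G (Y t \<omega>) - G (Y s \<omega>) - G1 (Y s \<omega>) * \<Delta> \<omega> - G2 (Y s \<omega>) * (\<Delta> \<omega>)\<^sup>2 / 2" for \<omega>
  have R_int: "integrable Q R"
    using I I1 I2 by (simp add: R_def[abs_def])
  have R_eq: "(\<integral>\<omega>. R \<omega> \<partial>Q) = (\<integral>\<omega>. G (Y t \<omega>) \<partial>Q) - (\<integral>\<omega>. G (Y s \<omega>) \<partial>Q) -
      (\<integral>\<omega>. G1 (Y s \<omega>) \<partial>Q) * (a * \<delta>) - (\<integral>\<omega>. G2 (Y s \<omega>) \<partial>Q) * (a\<^sup>2 * \<delta>\<^sup>2 + \<sigma>\<^sup>2 * \<delta>) / 2"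
    using I I1 I2 by (simp add: R_def[abs_def])
  \<comment> \<open>The 8 comes from splitting the cube of drift plus noise; with the factor 2 of
    the third moment it becomes 16.\<close>
  have "\<bar>\<integral>\<omega>. R \<omega> \<partial>Q\<bar> \<le> (\<integral>\<omega>. B * (8 * (\<bar>a\<bar> ^ 3 * \<delta> ^ 3 + \<bar>\<sigma>\<bar> ^ 3 * \<bar>N \<omega>\<bar> ^ 3)) \<partial>Q)"
  proof (rule abs_integral_le[OF R_int])
    fix \<omega>
    have "Y t \<omega> - Y s \<omega> = \<Delta> \<omega>"
      by (simp add: Y_def \<Delta>_def N_def \<delta>_def algebra_simps)
    then have "\<bar>R \<omega>\<bar> \<le> B * \<bar>\<Delta> \<omega>\<bar> ^ 3"
      using taylor2_bound[OF D bdd(4), of "Y t \<omega>" "Y s \<omega>"] by (simp add: R_def)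
    also have "\<bar>\<Delta> \<omega>\<bar> ^ 3 \<le> (\<bar>a\<bar> * \<delta> + \<bar>\<sigma>\<bar> * \<bar>N \<omega>\<bar>) ^ 3"
      using \<open>\<delta> > 0\<close> unfolding \<Delta>_def
      by (intro power_mono order_trans[OF abs_triangle_ineq]) (simp_all add: abs_mult)
    also have "\<dots> \<le> 8 * (\<bar>a\<bar> ^ 3 * \<delta> ^ 3 + \<bar>\<sigma>\<bar> ^ 3 * \<bar>N \<omega>\<bar> ^ 3)"
      using power3_sum_le[of "\<bar>a\<bar> * \<delta>" "\<bar>\<sigma>\<bar> * \<bar>N \<omega>\<bar>"] \<open>\<delta> > 0\<close> by (simp add: power_mult_distrib)
    finally show "\<bar>R \<omega>\<bar> \<le> B * (8 * (\<bar>a\<bar> ^ 3 * \<delta> ^ 3 + \<bar>\<sigma>\<bar> ^ 3 * \<bar>N \<omega>\<bar> ^ 3))"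
      using \<open>B \<ge> 0\<close> by (simp add: mult_left_mono)
  qed (use N(5) in simp)
  also have "\<dots> = B * (8 * (\<bar>a\<bar> ^ 3 * \<delta> ^ 3 + \<bar>\<sigma>\<bar> ^ 3 * (\<integral>\<omega>. \<bar>N \<omega>\<bar> ^ 3 \<partial>Q)))"
    using N(5) by (simp add: prob_space)
  also have "\<dots> \<le> B * (8 * (\<bar>a\<bar> ^ 3 * \<delta> ^ 3 + \<bar>\<sigma>\<bar> ^ 3 * (2 * \<delta> * sqrt \<delta>)))"
    using \<open>B \<ge> 0\<close> N(6) by (intro mult_left_mono add_left_mono) auto
  also have "\<dots> = \<delta> * (B * (8 * \<bar>a\<bar> ^ 3 * \<delta>\<^sup>2 + 16 * \<bar>\<sigma>\<bar> ^ 3 * sqrt \<delta>))"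
    by (simp add: power2_eq_square power3_eq_cube algebra_simps)
  finally have R_le: "\<bar>\<integral>\<omega>. R \<omega> \<partial>Q\<bar> \<le> \<delta> * (B * (8 * \<bar>a\<bar> ^ 3 * \<delta>\<^sup>2 + 16 * \<bar>\<sigma>\<bar> ^ 3 * sqrt \<delta>))" .
  \<comment> \<open>The part a^2 delta^2 of the second moment is not in the bracket; bounding the
    expectation of G2 by B moves it into the error.\<close>
  have "\<bar>\<integral>\<omega>. G2 (Y s \<omega>) \<partial>Q\<bar> \<le> (\<integral>\<omega>. B \<partial>Q)"
    using I(3) bdd(3) by (intro abs_integral_le) auto
  then have "\<bar>\<integral>\<omega>. G2 (Y s \<omega>) \<partial>Q\<bar> \<le> B"
    by (simp add: prob_space)
  then have "\<bar>\<integral>\<omega>. G2 (Y s \<omega>) \<partial>Q\<bar> * (a\<^sup>2 * \<delta>\<^sup>2 / 2) \<le> B * (a\<^sup>2 * \<delta>\<^sup>2 / 2)"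
    by (rule mult_right_mono) simp
  also have "\<dots> \<le> B * (a\<^sup>2 * \<delta>\<^sup>2)"
    using \<open>B \<ge> 0\<close> by (intro mult_left_mono) auto
  finally have "\<bar>(\<integral>\<omega>. G2 (Y s \<omega>) \<partial>Q) * (a\<^sup>2 * \<delta>\<^sup>2 / 2)\<bar> \<le> \<delta> * (B * (a\<^sup>2 * \<delta>))"
    by (simp add: abs_mult power2_eq_square mult_ac)
  with R_le have "\<bar>(\<integral>\<omega>. R \<omega> \<partial>Q) + (\<integral>\<omega>. G2 (Y s \<omega>) \<partial>Q) * (a\<^sup>2 * \<delta>\<^sup>2 / 2)\<bar> \<le>
      \<delta> * (B * (8 * \<bar>a\<bar> ^ 3 * \<delta>\<^sup>2 + 16 * \<bar>\<sigma>\<bar> ^ 3 * sqrt \<delta>)) + \<delta> * (B * (a\<^sup>2 * \<delta>))"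
    by linarith
  then show ?thesis
    unfolding R_eq by (simp add: field_simps)
qed

lemma expectation_Y_has_derivative:
  fixes G G1 G2 G3 :: "real \<Rightarrow> real"
  assumes D: "\<And>v. (G has_real_derivative G1 v) (at v)" "\<And>v. (G1 has_real_derivative G2 v) (at v)"
      "\<And>v. (G2 has_real_derivative G3 v) (at v)"
    and bdd: "\<And>v. \<bar>G v\<bar> \<le> B" "\<And>v. \<bar>G1 v\<bar> \<le> B" "\<And>v. \<bar>G2 v\<bar> \<le> B" "\<And>v. \<bar>G3 v\<bar> \<le> B"
    and "w \<ge> 0"
  shows "((\<lambda>t. \<integral>\<omega>. G (Y t \<omega>) \<partial>Q) has_real_derivative
      a * (\<integral>\<omega>. G1 (Y w \<omega>) \<partial>Q) + \<sigma>\<^sup>2 / 2 * (\<integral>\<omega>. G2 (Y w \<omega>) \<partial>Q)) (at w within {0..})"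
proof -
  define h h1 h2 k where "h t = (\<integral>\<omega>. G (Y t \<omega>) \<partial>Q)" and "h1 t = (\<integral>\<omega>. G1 (Y t \<omega>) \<partial>Q)"
    and "h2 t = (\<integral>\<omega>. G2 (Y t \<omega>) \<partial>Q)" and "k t = a * h1 t + \<sigma>\<^sup>2 / 2 * h2 t" for t
  \<comment> \<open>\<open>e1\<close> is the error of the expansion per unit of time,
    \<open>e2\<close> a modulus of continuity of the candidate derivative \<open>k\<close>.\<close>
  define e1 where "e1 \<delta> = B * (a\<^sup>2 * \<delta> + 8 * \<bar>a\<bar> ^ 3 * \<delta>\<^sup>2 + 16 * \<bar>\<sigma>\<bar> ^ 3 * sqrt \<delta>)" for \<delta>
  define e2 where "e2 \<delta> = (\<bar>a\<bar> + \<sigma>\<^sup>2 / 2) * (B * (\<bar>a\<bar> * \<delta> + \<bar>\<sigma>\<bar> * sqrt \<delta>))" for \<delta>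
  have "B \<ge> 0"
    using bdd(1)[of 0] by linarith
  have expansion: "\<bar>h t - h s - (t - s) * k s\<bar> \<le> (t - s) * e1 (t - s)" if "0 \<le> s" "s < t" for s t
    using expectation_Y_expansion[OF that D bdd] by (simp add: h_def h1_def h2_def k_def e1_def)
  have k_cont: "\<bar>k t - k s\<bar> \<le> e2 (t - s)" if "0 \<le> s" "s < t" for s t
  proof -
    let ?c = "B * (\<bar>a\<bar> * (t - s) + \<bar>\<sigma>\<bar> * sqrt (t - s))"
    have c: "\<bar>h1 t - h1 s\<bar> \<le> ?c" "\<bar>h2 t - h2 s\<bar> \<le> ?c"
      using expectation_Y_continuity[OF that D(2) bdd(2,3)] expectation_Y_continuity[OF that D(3) bdd(3,4)]
      by (simp_all add: h1_def h2_def)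
    have "k t - k s = a * (h1 t - h1 s) + \<sigma>\<^sup>2 / 2 * (h2 t - h2 s)"
      by (simp add: k_def field_simps)
    also have "\<bar>\<dots>\<bar> \<le> \<bar>a\<bar> * \<bar>h1 t - h1 s\<bar> + \<sigma>\<^sup>2 / 2 * \<bar>h2 t - h2 s\<bar>"
      by (rule order_trans[OF abs_triangle_ineq]) (simp add: abs_mult)
    also have "\<dots> \<le> \<bar>a\<bar> * ?c + \<sigma>\<^sup>2 / 2 * ?c"
      using c by (intro add_mono mult_left_mono) auto
    finally show ?thesis
      by (simp add: e2_def distrib_right)
  qed
  have e2_nonneg: "e2 \<delta> \<ge> 0" if "\<delta> \<ge> 0" for \<delta>
    using that \<open>B \<ge> 0\<close> by (simp add: e2_def)
  have "(h has_real_derivative k w) (at w within {0..})"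
  proof (rule has_real_derivative_boundI)
    fix z :: real assume "z \<in> {0..}"
    then have "z \<ge> 0" by simp
    consider "z = w" | "w < z" | "z < w" by linarith
    then show "\<bar>h z - h w - (z - w) * k w\<bar> \<le> \<bar>z - w\<bar> * (e1 \<bar>z - w\<bar> + e2 \<bar>z - w\<bar>)"
    proof cases
      case 2
      have "\<bar>h z - h w - (z - w) * k w\<bar> \<le> (z - w) * e1 (z - w)"
        using expansion \<open>w \<ge> 0\<close> 2 by blast
      also have "\<dots> \<le> (z - w) * (e1 (z - w) + e2 (z - w))"
        using e2_nonneg 2 by (intro mult_left_mono) auto
      finally show ?thesis using 2 by simp
    next
      \<comment> \<open>The expansion has to start at the earlier time z; replacing k z by k w costs
        (w - z) * e2 (w - z).\<close>
      case 3
      have "\<bar>h w - h z - (w - z) * k z\<bar> \<le> (w - z) * e1 (w - z)"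
        using expansion \<open>z \<ge> 0\<close> 3 by blast
      moreover have "\<bar>(w - z) * (k w - k z)\<bar> \<le> (w - z) * e2 (w - z)"
        using k_cont[OF \<open>z \<ge> 0\<close> 3] 3 by (simp add: abs_mult)
      moreover have "h z - h w - (z - w) * k w = - (h w - h z - (w - z) * k z) + (w - z) * (k w - k z)"
        by (simp add: algebra_simps)
      ultimately show ?thesis using 3 by (simp add: distrib_left)
    qed simp
  next
    show "((\<lambda>z. e1 \<bar>z - w\<bar> + e2 \<bar>z - w\<bar>) \<longlongrightarrow> 0) (at w within {0..})"
      unfolding e1_def e2_def by (rule tendsto_eq_intros refl | simp)+
  qed
  then show ?thesis
    by (simp add: h_def[abs_def] k_def h1_def h2_def)
qed

end

subsection \<open>The Black--Scholes equation\<close>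

text \<open>In the variables tau = T - t and y = ln x the undiscounted price H satisfies H_tau = a
  H_y + sigma^2/2 H_yy, with constant coefficients; the rest is the chain rule and the discount
  factor.\<close>

lemma price_solves_black_scholes:
  fixes r \<sigma> T :: real
  assumes g: "C3_compact_support g" and BM: "brownian_motion Q W"
  shows "solves_black_scholes r \<sigma> T (price r \<sigma> T g Q W)"
proof -
  from BM interpret prob_space Q
    by (simp add: brownian_motion_def)
  define a where "a = r - \<sigma>\<^sup>2 / 2"
  define G where "G y = g (exp y)" for y
  obtain G1 G2 G3 :: "real \<Rightarrow> real" and B where
    D: "\<And>y. (G has_real_derivative G1 y) (at y)" "\<And>y. (G1 has_real_derivative G2 y) (at y)"
      "\<And>y. (G2 has_real_derivative G3 y) (at y)"
    and bdd: "\<And>y. \<bar>G y\<bar> \<le> B" "\<And>y. \<bar>G1 y\<bar> \<le> B" "\<And>y. \<bar>G2 y\<bar> \<le> B" "\<And>y. \<bar>G3 y\<bar> \<le> B"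
    by (rule C3_compact_support_log_derivatives[OF g, folded G_def]) (rule that)
  define H where "H \<phi> \<tau> y = (\<integral>\<omega>. \<phi> (y + (a * \<tau> + \<sigma> * W \<tau> \<omega>)) \<partial>Q)"
    for \<phi> :: "real \<Rightarrow> real" and \<tau> y
  define E where "E t = exp (- r * (T - t))" for t
  have price_eq: "price r \<sigma> T g Q W t x = E t * H G (T - t) (ln x)" if "x > 0" for t x
    using that by (simp add: price_def stock_price_def H_def G_def a_def E_def exp_add)
  have H_y: "((\<lambda>y. H G \<tau> y) has_real_derivative H G1 \<tau> y) (at y)"
    "((\<lambda>y. H G1 \<tau> y) has_real_derivative H G2 \<tau> y) (at y)" if "\<tau> \<ge> 0" for \<tau> y
  proof -
    have [measurable]: "W \<tau> \<in> borel_measurable Q"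
      using BM that by (simp add: brownian_motion_def)
    have X: "(\<lambda>\<omega>. a * \<tau> + \<sigma> * W \<tau> \<omega>) \<in> borel_measurable Q"
      by measurable
    show "((\<lambda>y. H G \<tau> y) has_real_derivative H G1 \<tau> y) (at y)"
      unfolding H_def by (rule has_derivative_expectation_shift[OF X D(1,2) bdd(1-3)])
    show "((\<lambda>y. H G1 \<tau> y) has_real_derivative H G2 \<tau> y) (at y)"
      unfolding H_def by (rule has_derivative_expectation_shift[OF X D(2,3) bdd(2-4)])
  qed
  have H_\<tau>: "((\<lambda>\<tau>. H G \<tau> y) has_real_derivative a * H G1 \<tau> y + \<sigma>\<^sup>2 / 2 * H G2 \<tau> y) (at \<tau> within {0..})"
    if "\<tau> \<ge> 0" for \<tau> y
    unfolding H_def by (rule expectation_Y_has_derivative[OF BM D bdd that])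
  define F_t where "F_t t x = E t * (r * H G (T - t) (ln x) -
      (a * H G1 (T - t) (ln x) + \<sigma>\<^sup>2 / 2 * H G2 (T - t) (ln x)))" for t x
  define F_x where "F_x t x = E t * (H G1 (T - t) (ln x) / x)" for t x
  define F_xx where "F_xx t x = E t * ((H G2 (T - t) (ln x) - H G1 (T - t) (ln x)) / x\<^sup>2)" for t x
  show ?thesis
    unfolding solves_black_scholes_def
  proof (intro exI ballI allI impI conjI)
    fix t x :: real assume t: "t \<in> {0..T}" and x: "x > 0"
    then have \<tau>: "T - t \<ge> 0" by simp
    \<comment> \<open>Reflection maps {0..T} into {0..}, so the derivative at Brownian time 0
      becomes the one-sided derivative at t = T.\<close>
    have d1: "((\<lambda>\<tau>. H G \<tau> (ln x)) has_real_derivative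
        a * H G1 (T - t) (ln x) + \<sigma>\<^sup>2 / 2 * H G2 (T - t) (ln x)) (at (T - t) within (\<lambda>s. T - s) ` {0..T})"
      by (rule DERIV_subset[OF H_\<tau>[OF \<tau>]]) auto
    have d2: "((\<lambda>s. T - s) has_real_derivative - 1) (at t within {0..T})"
      by (auto intro!: derivative_eq_intros)
    have "((\<lambda>s. H G (T - s) (ln x)) has_real_derivative
        (a * H G1 (T - t) (ln x) + \<sigma>\<^sup>2 / 2 * H G2 (T - t) (ln x)) * - 1) (at t within {0..T})"
      using DERIV_image_chain[OF d1 d2] by (simp only: o_def)
    moreover have "(E has_real_derivative r * E t) (at t within {0..T})"
      unfolding E_def[abs_def] by (auto intro!: derivative_eq_intros)
    ultimately have "((\<lambda>s. E s * H G (T - s) (ln x)) has_real_derivative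
        r * E t * H G (T - t) (ln x) + (a * H G1 (T - t) (ln x) + \<sigma>\<^sup>2 / 2 * H G2 (T - t) (ln x)) * - 1 * E t)
        (at t within {0..T})"
      by (intro DERIV_mult)
    also have "r * E t * H G (T - t) (ln x) +
        (a * H G1 (T - t) (ln x) + \<sigma>\<^sup>2 / 2 * H G2 (T - t) (ln x)) * - 1 * E t = F_t t x"
      by (simp add: F_t_def ring_distribs mult_ac)
    finally have "((\<lambda>s. E s * H G (T - s) (ln x)) has_real_derivative F_t t x) (at t within {0..T})" .
    then show "((\<lambda>s. price r \<sigma> T g Q W s x) has_real_derivative F_t t x) (at t within {0..T})"
      using x by (simp add: price_eq)
    have Hx: "((\<lambda>y. H G (T - t) (ln y)) has_real_derivative H G1 (T - t) (ln x) * (1 / x)) (at x)"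
      "((\<lambda>y. H G1 (T - t) (ln y)) has_real_derivative H G2 (T - t) (ln x) * (1 / x)) (at x)"
      by (rule DERIV_chain2[OF H_y(1)[OF \<tau>] DERIV_ln_divide[OF x]])
        (rule DERIV_chain2[OF H_y(2)[OF \<tau>] DERIV_ln_divide[OF x]])
    have "((\<lambda>y. E t * H G (T - t) (ln y)) has_real_derivative F_x t x) (at x)"
      using DERIV_cmult[OF Hx(1), of "E t"] by (simp add: F_x_def)
    \<comment> \<open>The formula through ln is available for positive prices only, hence the open
      half-line.\<close>
    then show "((\<lambda>y. price r \<sigma> T g Q W t y) has_real_derivative F_x t x) (at x)"
      by (rule has_field_derivative_transform_within_open[where S = "{0<..}"])
        (use x in \<open>auto simp: price_eq\<close>)
    show "((\<lambda>y. F_x t y) has_real_derivative F_xx t x) (at x)"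
      using DERIV_cmult[OF DERIV_divide[OF Hx(2) DERIV_ident], of "E t"] x
      by (simp add: F_x_def F_xx_def power2_eq_square)
    \<comment> \<open>The terms in \<open>H G\<close> and \<open>H G2\<close> cancel, and
      \<open>H G1\<close> keeps the coefficient r - a - sigma^2/2 = 0.\<close>
    show "F_t t x + r * x * F_x t x + 1 / 2 * \<sigma>\<^sup>2 * x\<^sup>2 * F_xx t x - r * price r \<sigma> T g Q W t x = 0"
      using x by (simp add: F_t_def F_x_def F_xx_def price_eq a_def) (simp add: field_simps)
  qed
qed

section \<open>Grid times, discounting and assembly\<close>

lemma C3_compact_support_continuous_bounded:
  assumes "C3_compact_support g"
  obtains B where "continuous_on UNIV g" "\<And>y. \<bar>g y\<bar> \<le> B"
proof -
  from assms have "\<forall>k<3. \<forall>x. ((deriv ^^ k) g) differentiable (at x)"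
    and K: "compact (closure {x. g x \<noteq> 0})"
    by (simp_all add: C3_compact_support_def)
  from this(1)[rule_format, of 0] have "continuous_on UNIV g"
    by (simp add: continuous_at_imp_continuous_on differentiable_imp_continuous_within)
  moreover have "g v = 0" if "v \<notin> closure {x. g x \<noteq> 0}" for v
    using that closure_subset[of "{x. g x \<noteq> 0}"] by auto
  ultimately show ?thesis
    using bounded_of_compact_support[OF _ K] that by blast
qed

lemma floor_mult_divide_tendsto:
  fixes t :: real
  shows "(\<lambda>m. real_of_int \<lfloor>t * 2 ^ (2 * m)\<rfloor> / 2 ^ (2 * m)) \<longlonglongrightarrow> t"
proof (rule real_tendsto_sandwich)
  show "(\<lambda>m. t - 1 / 2 ^ (2 * m)) \<longlonglongrightarrow> t"
    by real_asymp
  show "\<forall>\<^sub>F m in sequentially. t - 1 / 2 ^ (2 * m) \<le> real_of_int \<lfloor>t * 2 ^ (2 * m)\<rfloor> / 2 ^ (2 * m)"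
  proof (intro always_eventually allI)
    fix m
    have "t * 2 ^ (2 * m) - 1 \<le> real_of_int \<lfloor>t * 2 ^ (2 * m)\<rfloor>"
      by linarith
    then have "(t * 2 ^ (2 * m) - 1) / 2 ^ (2 * m) \<le> real_of_int \<lfloor>t * 2 ^ (2 * m)\<rfloor> / 2 ^ (2 * m)"
      by (rule divide_right_mono) simp
    then show "t - 1 / 2 ^ (2 * m) \<le> real_of_int \<lfloor>t * 2 ^ (2 * m)\<rfloor> / 2 ^ (2 * m)"
      by (simp add: diff_divide_distrib)
  qed
  show "\<forall>\<^sub>F m in sequentially. real_of_int \<lfloor>t * 2 ^ (2 * m)\<rfloor> / 2 ^ (2 * m) \<le> t"
    by (simp add: divide_le_eq)
qed simp

text \<open>With h = 2^-m, the power is exp (k ln (1 + r h^2)), where the logarithm is asymptotic to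
  r h^2 and k h^2 tends to s. The integer k may be negative, as it is when discounting.\<close>

lemma interest_factor_powi_tendsto:
  fixes k :: "nat \<Rightarrow> int"
  assumes "r > 0" and k: "(\<lambda>m. real_of_int (k m) / 2 ^ (2 * m)) \<longlonglongrightarrow> s"
  shows "(\<lambda>m. interest_factor r m powi k m) \<longlonglongrightarrow> exp (r * s)"
proof -
  have "(\<lambda>m. ln (1 + r / 2 ^ (2 * m)) * 2 ^ (2 * m)) \<longlonglongrightarrow> r"
    using \<open>r > 0\<close> by real_asymp
  from tendsto_exp[OF tendsto_mult[OF this k]]
  have "(\<lambda>m. exp (real_of_int (k m) * ln (1 + r / 2 ^ (2 * m)))) \<longlonglongrightarrow> exp (r * s)"
    by (simp add: mult_ac)
  also have "(\<lambda>m. exp (real_of_int (k m) * ln (1 + r / 2 ^ (2 * m)))) = (\<lambda>m. interest_factor r m powi k m)"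
  proof
    fix m
    have pos: "interest_factor r m > 0"
      using \<open>r > 0\<close> by (simp add: interest_factor_def add_pos_pos)
    then show "exp (real_of_int (k m) * ln (1 + r / 2 ^ (2 * m))) = interest_factor r m powi k m"
      using powr_real_of_int'[of "interest_factor r m" "k m"] by (simp add: powr_def interest_factor_def)
  qed
  finally show ?thesis .
qed

lemma grid_index_grid_floor: "grid_index m (grid_floor m t) = grid_index m t"
  by (simp add: grid_index_def grid_floor_def)

lemma grid_index_mono: "s \<le> t \<Longrightarrow> grid_index m s \<le> grid_index m t"
  by (simp add: grid_index_def floor_mono)

text \<open>Monotonicity of the floor makes the difference nonnegative, so \<open>nat\<close>
  truncates nothing.\<close>

lemma grid_time_grid_index_diff:
  assumes "t \<le> T"
  shows "grid_time m (nat (grid_index m T - grid_index m t)) = grid_floor m T - grid_floor m t"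
  using grid_index_mono[OF assms, of m] by (simp add: grid_time_def grid_floor_def diff_divide_distrib)

lemma price_at_maturity:
  assumes BM: "brownian_motion Q W" and g: "continuous_on UNIV g"
  shows "price r \<sigma> T g Q W T x = g x"
proof -
  from BM interpret prob_space Q
    by (simp add: brownian_motion_def)
  have [measurable]: "W 0 \<in> borel_measurable Q" "g \<in> borel_measurable borel"
    using BM g by (simp_all add: brownian_motion_def borel_measurable_continuous_onI)
  have "AE \<omega> in Q. W 0 \<omega> = 0"
    using BM by (simp add: brownian_motion_def)
  then have "(\<integral>\<omega>. g (stock_price r \<sigma> W x 0 \<omega>) \<partial>Q) = (\<integral>\<omega>. g x \<partial>Q)"
    by (intro integral_cong_AE) (auto simp: stock_price_def)
  then show ?thesis
    by (simp add: price_def prob_space)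
qed

theorem theorem4:
  fixes \<mu> \<sigma> r T :: real
    and g :: "real \<Rightarrow> real"
    and Qm :: "nat \<Rightarrow> real \<Rightarrow> 'a measure"
    and Sm :: "nat \<Rightarrow> real \<Rightarrow> 'a \<Rightarrow> real"
    and Q :: "'b measure"
    and W :: "real \<Rightarrow> 'b \<Rightarrow> real"
  assumes "\<sigma> > 0" and "r > 0" and "T > 0"
    and "C3_compact_support g"
    and "\<And>m x. 0 < q_up \<mu> \<sigma> r m \<Longrightarrow> q_up \<mu> \<sigma> r m < 1 \<Longrightarrow> x > 0
           \<Longrightarrow> binomial_chain \<mu> \<sigma> r m x (Qm m x) (Sm m)"
    and "brownian_motion Q W"
  shows "(\<forall>t x. 0 \<le> t \<and> t \<le> T \<and> x > 0 \<longrightarrow>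
            (\<forall>m. discrete_price r T g Qm Sm m (grid_floor m t) x =
               interest_factor r m powi (\<lfloor>t * 2 ^ (2 * m)\<rfloor> - \<lfloor>T * 2 ^ (2 * m)\<rfloor>) *
               (\<integral>\<omega>. g (Sm m (grid_floor m T - grid_floor m t) \<omega>) \<partial>(Qm m x))) \<and>
            (\<lambda>m. discrete_price r T g Qm Sm m (grid_floor m t) x)
               \<longlonglongrightarrow> price r \<sigma> T g Q W t x \<and>
            (\<lambda>m. interest_factor r m powi (\<lfloor>t * 2 ^ (2 * m)\<rfloor> - \<lfloor>T * 2 ^ (2 * m)\<rfloor>) *
               (\<integral>\<omega>. g (Sm m (grid_floor m T - grid_floor m t) \<omega>) \<partial>(Qm m x)))
               \<longlonglongrightarrow> exp (- r * (T - t)) * (\<integral>\<omega>. g (stock_price r \<sigma> W x (T - t) \<omega>) \<partial>Q) \<and>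
            exp (- r * (T - t)) * (\<integral>\<omega>. g (stock_price r \<sigma> W x (T - t) \<omega>) \<partial>Q)
               = price r \<sigma> T g Q W t x)
         \<and> solves_black_scholes r \<sigma> T (price r \<sigma> T g Q W)
         \<and> (\<forall>x>0. price r \<sigma> T g Q W T x = g x)"
proof -
  obtain B where g_cont: "continuous_on UNIV g" and g_bdd: "\<And>y. \<bar>g y\<bar> \<le> B"
    using C3_compact_support_continuous_bounded[OF assms(4)] by blast
  have discrete_eq: "discrete_price r T g Qm Sm m (grid_floor m t) x =
      interest_factor r m powi (\<lfloor>t * 2 ^ (2 * m)\<rfloor> - \<lfloor>T * 2 ^ (2 * m)\<rfloor>) *
      (\<integral>\<omega>. g (Sm m (grid_floor m T - grid_floor m t) \<omega>) \<partial>(Qm m x))" if "t \<le> T" for m t x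
    unfolding discrete_price_def Let_def grid_index_grid_floor grid_time_grid_index_diff[OF that]
    by (simp add: grid_index_def)
  have limit: "(\<lambda>m. interest_factor r m powi (\<lfloor>t * 2 ^ (2 * m)\<rfloor> - \<lfloor>T * 2 ^ (2 * m)\<rfloor>) *
      (\<integral>\<omega>. g (Sm m (grid_floor m T - grid_floor m t) \<omega>) \<partial>(Qm m x)))
      \<longlonglongrightarrow> exp (- r * (T - t)) * (\<integral>\<omega>. g (stock_price r \<sigma> W x (T - t) \<omega>) \<partial>Q)"
    if t: "t \<le> T" and x: "x > 0" for t x
  proof (rule tendsto_mult)
    have diff: "(\<lambda>m. real_of_int (\<lfloor>t * 2 ^ (2 * m)\<rfloor> - \<lfloor>T * 2 ^ (2 * m)\<rfloor>) / 2 ^ (2 * m)) \<longlonglongrightarrow> t - T"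
      using tendsto_diff[OF floor_mult_divide_tendsto[of t] floor_mult_divide_tendsto[of T]]
      by (simp add: diff_divide_distrib)
    from interest_factor_powi_tendsto[OF \<open>r > 0\<close> this]
    show "(\<lambda>m. interest_factor r m powi (\<lfloor>t * 2 ^ (2 * m)\<rfloor> - \<lfloor>T * 2 ^ (2 * m)\<rfloor>)) \<longlonglongrightarrow> exp (- r * (T - t))"
      by (simp add: algebra_simps)
    define n where "n m = nat (grid_index m T - grid_index m t)" for m
    \<comment> \<open>The number of remaining steps is minus the exponent of the discount factor, so
      one floor limit serves both factors.\<close>
    have "real (n m) / 2 ^ (2 * m) = - (real_of_int (\<lfloor>t * 2 ^ (2 * m)\<rfloor> - \<lfloor>T * 2 ^ (2 * m)\<rfloor>) / 2 ^ (2 * m))" for m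
      using grid_index_mono[OF t, of m] by (simp add: n_def grid_index_def minus_divide_left)
    with tendsto_minus[OF diff] have "(\<lambda>m. real (n m) / 2 ^ (2 * m)) \<longlonglongrightarrow> T - t"
      by simp
    from discrete_expectation_tendsto[OF \<open>\<sigma> > 0\<close> x _ g_cont g_bdd this assms(5)[OF _ _ x] assms(6)] t
    show "(\<lambda>m. \<integral>\<omega>. g (Sm m (grid_floor m T - grid_floor m t) \<omega>) \<partial>(Qm m x))
        \<longlonglongrightarrow> (\<integral>\<omega>. g (stock_price r \<sigma> W x (T - t) \<omega>) \<partial>Q)"
      by (simp add: n_def grid_time_grid_index_diff)
  qed
  show ?thesis
  proof (intro conjI allI impI)
    fix t x :: real and m :: nat assume "0 \<le> t \<and> t \<le> T \<and> x > 0"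
    then have t: "t \<le> T" and x: "x > 0" by simp_all
    show "discrete_price r T g Qm Sm m (grid_floor m t) x =
        interest_factor r m powi (\<lfloor>t * 2 ^ (2 * m)\<rfloor> - \<lfloor>T * 2 ^ (2 * m)\<rfloor>) *
        (\<integral>\<omega>. g (Sm m (grid_floor m T - grid_floor m t) \<omega>) \<partial>(Qm m x))"
      by (rule discrete_eq[OF t])
    show "(\<lambda>m. discrete_price r T g Qm Sm m (grid_floor m t) x) \<longlonglongrightarrow> price r \<sigma> T g Q W t x"
      unfolding discrete_eq[OF t] price_def by (rule limit[OF t x])
    show "(\<lambda>m. interest_factor r m powi (\<lfloor>t * 2 ^ (2 * m)\<rfloor> - \<lfloor>T * 2 ^ (2 * m)\<rfloor>) *
        (\<integral>\<omega>. g (Sm m (grid_floor m T - grid_floor m t) \<omega>) \<partial>(Qm m x)))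
        \<longlonglongrightarrow> exp (- r * (T - t)) * (\<integral>\<omega>. g (stock_price r \<sigma> W x (T - t) \<omega>) \<partial>Q)"
      by (rule limit[OF t x])
    show "exp (- r * (T - t)) * (\<integral>\<omega>. g (stock_price r \<sigma> W x (T - t) \<omega>) \<partial>Q) = price r \<sigma> T g Q W t x"
      by (simp only: price_def)
  qed (rule price_solves_black_scholes[OF assms(4,6)], rule price_at_maturity[OF assms(6) g_cont])
qed

end
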